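(* Let $(\Omega,\Sigma,\mu)$ be a complete finite measure space. The class $\mathcal{RNP}$ of all complete Hausdorff locally convex spaces possessing the Radon-Nikodym property is properly contained in the class $\mathcal{RN}$ of all complete $B$-locally convex spaces; that is, every complete Hausdorff locally convex space with the Radon-Nikodym property is a $B$-locally convex space, and there exists a complete $B$-locally convex space which does not have the Radon-Nikodym property.
   Context: $(\Omega,\Sigma,\mu)$ is a fixed complete finite measure space (the notion of $B$-locally convex space refers to it). For a Hausdorff locally convex space $X$ with topology $\tau$, $\mathscr{P}$ is the family of all $\tau$-continuous seminorms on $X$, directed by the pointwise order $\le$. $L_1(\mu)$ is the space of Lebesgue integrable functions $\Omega\to\mathbb{R}$. A measurable simple function $g:\Omega\to X$ is a function with finitely many values $x_1,\dots,x_n$ such that $g^{-1}(x_i)\in\Sigma$ for each $i$; its integral over $E$ is $\sum_i \mu(E\cap g^{-1}(x_i))x_i$. $p$-Bochner integrability ($p\in\mathscr{P}$): $f:\Omega\to X$ is $p$-Bochner integrable if there are measurable simple functions $f_n^p:\Omega\to X$ and $Z_p\in\Sigma$ with $\mu(Z_p)=0$ such that (a) $p(f_n^p(t)-f(t))\to 0$ for all $t\in\Omega\setminus Z_p$; (b) $p(f_n^p(\cdot)-f(\cdot))\in L_1(\mu)$ and $\lim_n\int_\Omega p(f_n^p(t)-f(t))\,d\mu=0$; (c) for each $E\in\Sigma$ there is a vector $x_E^p(f)\in X$ with $\lim_n p\big(x_E^p(f)-\int_E f_n^p\,d\mu\big)=0$. Integrability by seminorm (over any complete finite measure space): $f:\Omega\to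 X$ is integrable by seminorm if for each $p\in\mathscr{P}$ there are $(f_n^p)$ and $Z_p$ satisfying (a), (b), and for each $E\in\Sigma$ there is a vector $x_E\in X$ (the same for all $p$) with $\lim_n p\big(x_E-\int_E f_n^p\,d\mu\big)=0$ for every $p\in\mathscr{P}$. One sets $\int_E f\,d\mu=x_E$. A net $(f_s)_{s\in\mathscr{P}}$ of functions $f_s:\Omega\to X$ is a net of pairwise almost the same functions if for all $p,q\in\mathscr{P}$ with $p\le q$ there is $Z_{pq}\in\Sigma$ with $\mu(Z_{pq})=0$ and $p(f_p(t)-f_q(t))=0$ for all $t\in\Omega\setminus Z_{pq}$. It is a net of pairwise almost the same Bochner integrable functions if moreover each $f_s$ is $s$-Bochner integrable. The space $X$ is a $B$-locally convex space if for each net $(f_s)_{s\in\mathscr{P}}$ of pairwise almost the same Bochner integrable functions there is a function $f:\Omega\to X$ such that $s(f(\cdot)-f_s(\cdot))\in L_1(\mu)$ and $\int_\Omega s(f(t)-f_s(t))\,d\mu=0$ for every $s\in\mathscr{P}$. A vector measure is a countably additive function $m$ from a $\sigma$-algebra to $X$. It is of bounded variation if for every $p\in\mathscr{P}$ the supremum of $\sum_{A\in\pi}p(m(A))$ over all finite partitions $\pi$ of the whole space into measurable sets is finite. $m\ll\mu$ means $m(Z)=0$ whenever $Z$ is measurable and $\mu(Z)=0$. A locally convex space $X$ has the Radon-Nikodym property if for every complete finite measure space $(\Omega',\Sigma',\mu')$ and every vector measure $m:\Sigma'\to X$ of bounded variation with $m\ll\mu'$, there is an integrable by seminorm function $f:\Omega'\to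 X$ (with respect to $\mu'$) such that $m(E)=\int_E f\,d\mu'$ for every $E\in\Sigma'$. *)

theory Defs
  imports "HOL-Analysis.Analysis"
begin

section \<open>Complete Hausdorff locally convex spaces\<close>

text \<open>
  The library has no type class of topological vector spaces. A locally convex space is given here
  by a real vector space type together with a topology \<open>T\<close> on it.
\<close>

definition hausdorff_lcs :: "'a::real_vector topology \<Rightarrow> bool" where
  "hausdorff_lcs T \<longleftrightarrow>
     topspace T = UNIV \<and>
     Hausdorff_space T \<and>
     continuous_map (prod_topology T T) T (\<lambda>(x, y). x + y) \<and>
     continuous_map (prod_topology euclideanreal T) T (\<lambda>(c, x). c *\<^sub>R x) \<and>
     (\<forall>U. openin T U \<and> 0 \<in> U \<longrightarrow> (\<exists>V. openin T V \<and> 0 \<in> V \<and> convex V \<and> V \<subseteq> U))"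

definition lcs_cauchy_filter :: "'a::real_vector topology \<Rightarrow> 'a filter \<Rightarrow> bool" where
  "lcs_cauchy_filter T F \<longleftrightarrow>
     F \<noteq> bot \<and>
     (\<forall>U. openin T U \<and> 0 \<in> U \<longrightarrow> eventually (\<lambda>(x, y). x - y \<in> U) (F \<times>\<^sub>F F))"

definition complete_lcs :: "'a::real_vector topology \<Rightarrow> bool" where
  "complete_lcs T \<longleftrightarrow>
     hausdorff_lcs T \<and> (\<forall>F. lcs_cauchy_filter T F \<longrightarrow> (\<exists>l. limitin T (\<lambda>x. x) l F))"

definition seminorm :: "('a::real_vector \<Rightarrow> real) \<Rightarrow> bool" where
  "seminorm p \<longleftrightarrow> (\<forall>x y. p (x + y) \<le> p x + p y) \<and> (\<forall>c x. p (c *\<^sub>R x) = \<bar>c\<bar> * p x)"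

definition cont_seminorms :: "'a::real_vector topology \<Rightarrow> ('a \<Rightarrow> real) set" where
  "cont_seminorms T = {p. seminorm p \<and> continuous_map T euclideanreal p}"


section \<open>Integration\<close>

definition complete_finite_measure :: "'w measure \<Rightarrow> bool" where
  "complete_finite_measure M \<longleftrightarrow> complete_measure M \<and> finite_measure M"

definition simple_integral_on :: "'w measure \<Rightarrow> ('w \<Rightarrow> 'a::real_vector) \<Rightarrow> 'w set \<Rightarrow> 'a" where
  "simple_integral_on M g E =
     (\<Sum>x\<in>g ` space M. measure M (E \<inter> (g -` {x} \<inter> space M)) *\<^sub>R x)"

text \<open>
  Conditions (a) and (b), common to both notions of integrability. The quantifier \<open>AE\<close> provides
  the null set \<open>Z\<^sub>p\<close>.
\<close>

definition seminorm_approx ::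
  "'w measure \<Rightarrow> ('a::real_vector \<Rightarrow> real) \<Rightarrow> ('w \<Rightarrow> 'a) \<Rightarrow> (nat \<Rightarrow> 'w \<Rightarrow> 'a) \<Rightarrow> bool" where
  "seminorm_approx M p f fs \<longleftrightarrow>
     (\<forall>n. simple_function M (fs n)) \<and>
     (AE t in M. (\<lambda>n. p (fs n t - f t)) \<longlonglongrightarrow> 0) \<and>
     (\<forall>n. integrable M (\<lambda>t. p (fs n t - f t))) \<and>
     (\<lambda>n. \<integral>t. p (fs n t - f t) \<partial>M) \<longlonglongrightarrow> 0"

definition seminorm_Bochner_integrable ::
  "'w measure \<Rightarrow> ('a::real_vector \<Rightarrow> real) \<Rightarrow> ('w \<Rightarrow> 'a) \<Rightarrow> bool" where
  "seminorm_Bochner_integrable M p f \<longleftrightarrow>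
     (\<exists>fs. seminorm_approx M p f fs \<and>
        (\<forall>E\<in>sets M. \<exists>x. (\<lambda>n. p (x - simple_integral_on M (fs n) E)) \<longlonglongrightarrow> 0))"

text \<open>
  \<open>I E\<close> is the vector \<open>x\<^sub>E\<close>, which must not depend on the seminorm \<open>p\<close>; it is unique for
  \<open>E \<in> sets M\<close> when \<open>T\<close> is a Hausdorff locally convex topology.
\<close>

definition has_integrals_by_seminorm ::
  "'a::real_vector topology \<Rightarrow> 'w measure \<Rightarrow> ('w \<Rightarrow> 'a) \<Rightarrow> ('w set \<Rightarrow> 'a) \<Rightarrow> bool" where
  "has_integrals_by_seminorm T M f I \<longleftrightarrow>
     (\<exists>fs. \<forall>p\<in>cont_seminorms T.
        seminorm_approx M p f (fs p) \<and>
        (\<forall>E\<in>sets M. (\<lambda>n. p (I E - simple_integral_on M (fs p n) E)) \<longlonglongrightarrow> 0))"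

definition integrable_by_seminorm ::
  "'a::real_vector topology \<Rightarrow> 'w measure \<Rightarrow> ('w \<Rightarrow> 'a) \<Rightarrow> bool" where
  "integrable_by_seminorm T M f \<longleftrightarrow> (\<exists>I. has_integrals_by_seminorm T M f I)"

definition integral_by_seminorm ::
  "'a::real_vector topology \<Rightarrow> 'w measure \<Rightarrow> ('w \<Rightarrow> 'a) \<Rightarrow> 'w set \<Rightarrow> 'a" where
  "integral_by_seminorm T M f = (SOME I. has_integrals_by_seminorm T M f I)"


section \<open>\<open>B\<close>-locally convex spaces\<close>

text \<open>
  A net \<open>f\<close> takes the seminorm as its first argument. Only its values at continuous seminorms
  matter; these are ordered by the pointwise order \<open>p \<le> q\<close> of functions.
\<close>

definition almost_same_net ::
  "'a::real_vector topology \<Rightarrow> 'w measure \<Rightarrow> (('a \<Rightarrow> real) \<Rightarrow> 'w \<Rightarrow> 'a) \<Rightarrow> bool" where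
  "almost_same_net T M f \<longleftrightarrow>
     (\<forall>p\<in>cont_seminorms T. \<forall>q\<in>cont_seminorms T.
        p \<le> q \<longrightarrow> (AE t in M. p (f p t - f q t) = 0))"

definition almost_same_Bochner_net ::
  "'a::real_vector topology \<Rightarrow> 'w measure \<Rightarrow> (('a \<Rightarrow> real) \<Rightarrow> 'w \<Rightarrow> 'a) \<Rightarrow> bool" where
  "almost_same_Bochner_net T M f \<longleftrightarrow>
     almost_same_net T M f \<and>
     (\<forall>s\<in>cont_seminorms T. seminorm_Bochner_integrable M s (f s))"

definition B_locally_convex :: "'w measure \<Rightarrow> 'a::real_vector topology \<Rightarrow> bool" where
  "B_locally_convex M T \<longleftrightarrow>
     hausdorff_lcs T \<and>
     (\<forall>f. almost_same_Bochner_net T M f \<longrightarrow>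
        (\<exists>g. \<forall>s\<in>cont_seminorms T.
           integrable M (\<lambda>t. s (g t - f s t)) \<and> (\<integral>t. s (g t - f s t) \<partial>M) = 0))"


section \<open>Vector measures and the Radon-Nikodym property\<close>

definition vector_measure ::
  "'a::real_vector topology \<Rightarrow> 'w measure \<Rightarrow> ('w set \<Rightarrow> 'a) \<Rightarrow> bool" where
  "vector_measure T M m \<longleftrightarrow>
     (\<forall>A :: nat \<Rightarrow> 'w set. range A \<subseteq> sets M \<and> disjoint_family A \<longrightarrow>
        limitin T (\<lambda>n. \<Sum>i<n. m (A i)) (m (\<Union>i. A i)) sequentially)"

definition of_bounded_variation ::
  "'a::real_vector topology \<Rightarrow> 'w measure \<Rightarrow> ('w set \<Rightarrow> 'a) \<Rightarrow> bool" where
  "of_bounded_variation T M m \<longleftrightarrow>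
     (\<forall>p\<in>cont_seminorms T.
        bdd_above {\<Sum>A\<in>\<pi>. p (m A) |\<pi>. finite \<pi> \<and> \<pi> \<subseteq> sets M \<and> partition_on (space M) \<pi>})"

definition absolutely_continuous_vm :: "'w measure \<Rightarrow> ('w set \<Rightarrow> 'a::real_vector) \<Rightarrow> bool" where
  "absolutely_continuous_vm M m \<longleftrightarrow> (\<forall>Z\<in>null_sets M. m Z = 0)"

text \<open>
  A formula of HOL cannot quantify over all types, so the measure spaces in the Radon-Nikodym
  property are those whose underlying set is an arbitrary subset of a type \<open>'u\<close>, the universe,
  which is a parameter of the definition. A universe is only large enough to be meaningful if it
  contains the measure spaces of interest, up to bijection; over a finite type, for instance, the
  Lebesgue measure is missing. Over larger universes the property can only become stronger.
\<close>

definition radon_nikodym_property :: "'u itself \<Rightarrow> 'a::real_vector topology \<Rightarrow> bool" where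
  "radon_nikodym_property U T \<longleftrightarrow>
     (\<forall>(N :: 'u measure) m.
        complete_finite_measure N \<and> vector_measure T N m \<and>
        of_bounded_variation T N m \<and> absolutely_continuous_vm N m \<longrightarrow>
        (\<exists>f. integrable_by_seminorm T N f \<and>
           (\<forall>E\<in>sets N. m E = integral_by_seminorm T N f E)))"

end

theory Submission
  imports Defs
begin

text \<open>
  The first half rests on completeness. Let the \<open>f p\<close> form a net of pairwise almost the same Bochner
  integrable functions, with \<open>p\<close>-integrals \<open>I p E\<close>. For \<open>p \<le> q\<close> the vectors \<open>I p E\<close> and \<open>I q E\<close> are
  \<open>p\<close>-indistinguishable, so in a complete space there is one vector \<open>m E\<close> that no \<open>p\<close> can tell from
  \<open>I p E\<close> (\<open>complete_lcs_net_limit\<close>). The set function \<open>m\<close> is finitely additive, and the estimate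
  \<open>p (m E) \<le> \<integral>\<^bsub>E\<^esub> p (f p)\<close> is strong enough to make it a vector measure of bounded variation that
  vanishes on null sets (\<open>dominated_vector_measure\<close>). Its density \<open>g\<close>, given by the Radon-Nikodym
  property, has the same \<open>p\<close>-integrals as \<open>f p\<close> over every set, and a function all of whose
  \<open>p\<close>-integrals are \<open>p\<close>-null is \<open>p\<close>-null almost everywhere (\<open>has_seminorm_integrals_zero\<close>).
  
  The separating example is \<open>\<ell>\<^sub>\<infinity>\<close> with its norm topology. In a normed space every continuous seminorm
  is at most a multiple of the norm, so the member of the net at the norm already agrees almost
  everywhere with all the others, for each seminorm (\<open>B_locally_convex_euclidean\<close>). The Radon-Nikodym
  property fails for the measure \<open>E \<mapsto> (\<lambda>(E \<inter> [q\<^sub>n, 1]))\<^sub>n\<close> on the unit interval, where \<open>q\<^sub>n\<close> enumerates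
  the rationals. A density would have to send almost every \<open>t\<close> to the sequence of truth values of
  \<open>q\<^sub>n \<le> t\<close>. Values at different points are then at distance at least \<open>1\<close>, whereas a density is almost
  everywhere a limit of functions with finitely many values; a countable set of points would have to
  have full Lebesgue measure (\<open>not_radon_nikodym_bcontfun\<close>).
  
  The Radon-Nikodym property speaks of measure spaces over the universe \<open>'u\<close>. Both halves apply it
  to other measure spaces by moving these along an injection into \<open>'u\<close> (\<open>radon_nikodym_density\<close>).
\<close>

section \<open>Seminorms\<close>

lemma seminorm_triangle: "seminorm p \<Longrightarrow> p (x + y) \<le> p x + p y"
  by (simp add: seminorm_def)

lemma seminorm_scaleR: "seminorm p \<Longrightarrow> p (c *\<^sub>R x) = \<bar>c\<bar> * p x"
  by (simp add: seminorm_def)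

lemma seminorm_zero [simp]: "seminorm p \<Longrightarrow> p 0 = 0"
  using seminorm_scaleR[of p 0 0] by simp

lemma seminorm_uminus: "seminorm p \<Longrightarrow> p (- x) = p x"
  using seminorm_scaleR[of p "-1" x] by simp

lemma seminorm_nonneg [simp]: "seminorm p \<Longrightarrow> 0 \<le> p x"
  using seminorm_triangle[of p x "- x"] seminorm_uminus[of p x] by simp

lemma seminorm_minus_commute: "seminorm p \<Longrightarrow> p (x - y) = p (y - x)"
  using seminorm_uminus[of p "x - y"] by simp

lemma seminorm_diff_triangle: "seminorm p \<Longrightarrow> p (x - z) \<le> p (x - y) + p (y - z)"
  using seminorm_triangle[of p "x - y" "y - z"] by simp

lemma seminorm_diff_le: "seminorm p \<Longrightarrow> p (x - y) \<le> p x + p y"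
  using seminorm_triangle[of p x "- y"] seminorm_uminus[of p y] by simp

lemma seminorm_le_diff: "seminorm p \<Longrightarrow> p x \<le> p (x - y) + p y"
  using seminorm_triangle[of p "x - y" y] by simp

lemma seminorm_reverse_triangle: "seminorm p \<Longrightarrow> \<bar>p x - p y\<bar> \<le> p (x - y)"
  using seminorm_le_diff[of p x y] seminorm_le_diff[of p y x] seminorm_minus_commute[of p x y]
  by linarith

lemma seminorm_sum: "seminorm p \<Longrightarrow> p (sum f A) \<le> (\<Sum>i\<in>A. p (f i))"
proof (induction A rule: infinite_finite_induct)
  case (insert x F)
  then show ?case using seminorm_triangle[of p "f x" "sum f F"] by simp
qed auto

section \<open>Integrals of simple functions\<close>

text \<open>
  The integral is defined through the level sets of the function itself. It may also be computed on
  any finer finite partition, here that of \<open>k\<close>; with \<open>k = (g, h)\<close> this gives linearity.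
\<close>

lemma simple_integral_on_compose:
  assumes M: "finite_measure M" and k: "simple_function M k" and E: "E \<in> sets M"
  shows "simple_integral_on M (\<lambda>t. \<phi> (k t)) E =
    (\<Sum>y\<in>k ` space M. measure M (E \<inter> (k -` {y} \<inter> space M)) *\<^sub>R \<phi> y)"
proof -
  interpret finite_measure M by fact
  let ?K = "k ` space M"
  have fin: "finite ?K" using k by (simp add: simple_function_def)
  have meas: "k -` {y} \<inter> space M \<in> sets M" for y
    using k by (rule simple_functionD)
  have "(\<Sum>y\<in>?K. measure M (E \<inter> (k -` {y} \<inter> space M)) *\<^sub>R \<phi> y) =
    (\<Sum>x\<in>\<phi> ` ?K. \<Sum>y\<in>{y \<in> ?K. \<phi> y = x}. measure M (E \<inter> (k -` {y} \<inter> space M)) *\<^sub>R \<phi> y)"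
    by (rule sum.image_gen[OF fin])
  also have "\<dots> = (\<Sum>x\<in>\<phi> ` ?K. measure M (E \<inter> ((\<lambda>t. \<phi> (k t)) -` {x} \<inter> space M)) *\<^sub>R x)"
  proof (rule sum.cong[OF refl])
    fix x
    let ?Y = "{y \<in> ?K. \<phi> y = x}"
    have "measure M (E \<inter> ((\<lambda>t. \<phi> (k t)) -` {x} \<inter> space M)) =
        measure M (\<Union>y\<in>?Y. E \<inter> (k -` {y} \<inter> space M))"
      by (rule arg_cong[where f = "measure M"]) auto
    also have "\<dots> = (\<Sum>y\<in>?Y. measure M (E \<inter> (k -` {y} \<inter> space M)))"
      using fin E meas by (intro finite_measure_finite_Union) (auto simp: disjoint_family_on_def)
    finally show "(\<Sum>y\<in>?Y. measure M (E \<inter> (k -` {y} \<inter> space M)) *\<^sub>R \<phi> y) =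
        measure M (E \<inter> ((\<lambda>t. \<phi> (k t)) -` {x} \<inter> space M)) *\<^sub>R x"
      by (simp add: scaleR_left.sum)
  qed
  finally show ?thesis
    by (simp add: simple_integral_on_def image_image)
qed

lemma simple_integral_on_diff:
  assumes M: "finite_measure M" and g: "simple_function M g" and h: "simple_function M h"
    and E: "E \<in> sets M"
  shows "simple_integral_on M (\<lambda>t. g t - h t) E = simple_integral_on M g E - simple_integral_on M h E"
proof -
  have k: "simple_function M (\<lambda>t. (g t, h t))" using g h by (rule simple_function_Pair)
  note rep = simple_integral_on_compose[OF M k E]
  have d: "simple_integral_on M (\<lambda>t. g t - h t) E =
      (\<Sum>y\<in>(\<lambda>t. (g t, h t)) ` space M.
        measure M (E \<inter> ((\<lambda>t. (g t, h t)) -` {y} \<inter> space M)) *\<^sub>R (fst y - snd y))"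
    using rep[of "\<lambda>y. fst y - snd y"] by simp
  show ?thesis
    unfolding d using rep[of fst] rep[of snd]
    by (simp only: scaleR_diff_right sum_subtractf fst_conv snd_conv)
qed

lemma simple_integral_on_Un:
  assumes M: "finite_measure M" and g: "simple_function M g"
    and E: "E \<in> sets M" "F \<in> sets M" "E \<inter> F = {}"
  shows "simple_integral_on M g (E \<union> F) = simple_integral_on M g E + simple_integral_on M g F"
proof -
  interpret finite_measure M by fact
  have "measure M ((E \<union> F) \<inter> (g -` {x} \<inter> space M)) =
    measure M (E \<inter> (g -` {x} \<inter> space M)) + measure M (F \<inter> (g -` {x} \<inter> space M))" for x
  proof -
    have "g -` {x} \<inter> space M \<in> sets M" using g by (rule simple_functionD)
    then show ?thesis using E
      by (subst finite_measure_Union[symmetric]) (auto intro!: arg_cong[where f = "measure M"])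
  qed
  then show ?thesis by (simp add: simple_integral_on_def scaleR_add_left sum.distrib)
qed

lemma
  fixes \<phi> :: "'a \<Rightarrow> real"
  assumes M: "finite_measure M" and g: "simple_function M g"
  shows integrable_simple_compose: "integrable M (\<lambda>t. \<phi> (g t))"
    and set_integral_simple_compose: "E \<in> sets M \<Longrightarrow> (LINT t:E|M. \<phi> (g t)) =
      (\<Sum>x\<in>g ` space M. measure M (E \<inter> (g -` {x} \<inter> space M)) * \<phi> x)"
proof -
  interpret finite_measure M by fact
  have fin: "finite (g ` space M)" using g by (simp add: simple_function_def)
  have meas: "g -` {x} \<inter> space M \<in> sets M" for x
    using g by (rule simple_functionD)
  have rep: "indicator E t * \<phi> (g t) =
      (\<Sum>x\<in>g ` space M. indicator (E \<inter> (g -` {x} \<inter> space M)) t * \<phi> x)" if "t \<in> space M" for t E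
  proof -
    have "(\<Sum>x\<in>g ` space M. indicator (E \<inter> (g -` {x} \<inter> space M)) t * \<phi> x) =
        (\<Sum>x\<in>g ` space M. if x = g t then indicator E t * \<phi> x else 0)"
      using that by (intro sum.cong refl) (auto simp: indicator_def)
    then show ?thesis using fin that by simp
  qed
  have int: "integrable M (\<lambda>t. indicator (E \<inter> (g -` {x} \<inter> space M)) t * \<phi> x)"
    if "E \<in> sets M" for E x
    using that meas[of x]
    by (intro integrable_mult_left) (auto simp: integrable_indicator_iff less_top[symmetric])
  have "integrable M (\<lambda>t. indicator (space M) t * \<phi> (g t))"
    using int[of "space M"] by (subst Bochner_Integration.integrable_cong[OF refl rep]) auto
  then show "integrable M (\<lambda>t. \<phi> (g t))"
    by (rule Bochner_Integration.integrable_cong[THEN iffD1, rotated 2]) auto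
  assume E: "E \<in> sets M"
  have "(LINT t:E|M. \<phi> (g t)) =
      (\<integral>t. (\<Sum>x\<in>g ` space M. indicator (E \<inter> (g -` {x} \<inter> space M)) t * \<phi> x) \<partial>M)"
    unfolding set_lebesgue_integral_def
    by (rule Bochner_Integration.integral_cong) (simp_all add: rep)
  also have "\<dots> = (\<Sum>x\<in>g ` space M. \<integral>t. indicator (E \<inter> (g -` {x} \<inter> space M)) t * \<phi> x \<partial>M)"
    using int[OF E] by (rule Bochner_Integration.integral_sum)
  also have "\<dots> = (\<Sum>x\<in>g ` space M. measure M (E \<inter> (g -` {x} \<inter> space M)) * \<phi> x)"
    using E meas by (intro sum.cong) auto
  finally show "(LINT t:E|M. \<phi> (g t)) =
      (\<Sum>x\<in>g ` space M. measure M (E \<inter> (g -` {x} \<inter> space M)) * \<phi> x)" .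
qed

lemma seminorm_simple_integral_le:
  assumes p: "seminorm p" and M: "finite_measure M" and g: "simple_function M g" and E: "E \<in> sets M"
  shows "p (simple_integral_on M g E) \<le> (LINT t:E|M. p (g t))"
  unfolding set_integral_simple_compose[OF M g E] simple_integral_on_def
  by (rule order_trans[OF seminorm_sum[OF p]]) (simp add: seminorm_scaleR[OF p])

section \<open>Integrals with respect to one seminorm\<close>

lemma complete_measure_measurable_AE:
  fixes f g :: "'w \<Rightarrow> 'b::topological_space"
  assumes M: "complete_measure M" and g: "g \<in> borel_measurable M" and eq: "AE t in M. f t = g t"
  shows "f \<in> borel_measurable M"
proof (rule borel_measurableI)
  interpret complete_measure M by fact
  fix S :: "'b set" assume "open S"
  then have "g -` S \<inter> space M \<in> sets M" using g by (simp add: measurable_sets)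
  moreover have "AE t in M. t \<in> g -` S \<inter> space M \<longleftrightarrow> t \<in> f -` S \<inter> space M"
    using eq by eventually_elim auto
  ultimately show "f -` S \<inter> space M \<in> sets M"
    using in_sets_AE by blast
qed

text \<open>
  The values of \<open>f\<close> lie in a space without a Borel structure, so measurability of
  \<open>p \<circ> (g - f)\<close> has to come from the approximation. The reverse triangle inequality exhibits
  this function as an almost everywhere limit of the real simple functions \<open>p \<circ> (g - fs n)\<close>, and
  completeness of the measure removes the exceptional null set.
\<close>

lemma borel_measurable_seminorm_limit:
  assumes M: "complete_finite_measure M" and p: "seminorm p"
    and fs: "\<And>n. simple_function M (fs n)"
    and lim: "AE t in M. (\<lambda>n. p (fs n t - f t)) \<longlonglongrightarrow> 0"
    and g: "simple_function M g"
  shows "(\<lambda>t. p (g t - f t)) \<in> borel_measurable M"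
proof -
  have c: "complete_measure M" using M by (simp add: complete_finite_measure_def)
  obtain N where N: "N \<in> null_sets M" and "{t \<in> space M. \<not> (\<lambda>n. p (fs n t - f t)) \<longlonglongrightarrow> 0} \<subseteq> N"
    using lim by (auto simp: eventually_ae_filter)
  then have conv: "(\<lambda>n. p (fs n t - f t)) \<longlonglongrightarrow> 0" if "t \<in> space M - N" for t
    using that by auto
  let ?h = "\<lambda>t. if t \<in> N then 0 else p (g t - f t)"
  have "?h \<in> borel_measurable M"
  proof (rule borel_measurable_LIMSEQ_real)
    fix n
    have "simple_function M (\<lambda>t. p (g t - fs n t))"
      using fs[of n] g by (intro simple_function_compose1[of _ _ p] simple_function_diff)
    then have "(\<lambda>t. p (g t - fs n t)) \<in> borel_measurable M"
      by (rule borel_measurable_simple_function)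
    then show "(\<lambda>t. if t \<in> N then 0 else p (g t - fs n t)) \<in> borel_measurable M"
      using N by (intro measurable_If_set) (auto simp: sets.Int_space_eq1)
  next
    fix t assume t: "t \<in> space M"
    show "(\<lambda>n. if t \<in> N then 0 else p (g t - fs n t)) \<longlonglongrightarrow> ?h t"
    proof (cases "t \<in> N")
      case False
      have "\<bar>p (g t - fs n t) - p (g t - f t)\<bar> \<le> p (fs n t - f t)" for n
        using seminorm_reverse_triangle[OF p, of "g t - fs n t" "g t - f t"]
          seminorm_minus_commute[OF p] by simp
      then have "\<forall>\<^sub>F n in sequentially. norm (p (g t - fs n t) - p (g t - f t)) \<le> p (fs n t - f t)"
        by (auto intro!: always_eventually)
      moreover have "(\<lambda>n. p (fs n t - f t)) \<longlonglongrightarrow> 0"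
        using conv t False by blast
      ultimately have "(\<lambda>n. p (g t - fs n t) - p (g t - f t)) \<longlonglongrightarrow> 0"
        by (rule Lim_null_comparison)
      then show ?thesis using False by (simp add: LIM_zero_iff)
    qed simp
  qed
  moreover have "AE t in M. p (g t - f t) = ?h t"
    using AE_not_in[OF N] by eventually_elim simp
  ultimately show ?thesis by (rule complete_measure_measurable_AE[OF c])
qed

text \<open>
  The Bochner integrability of a function with respect to a single seminorm, with the indefinite
  integral \<open>I\<close> made explicit. The values of \<open>I\<close> are determined only up to vectors on which \<open>p\<close>
  vanishes, and only on measurable sets. Integrability by seminorm says that one \<open>I\<close> serves all
  continuous seminorms.
\<close>

definition has_seminorm_integrals ::
  "'w measure \<Rightarrow> ('a::real_vector \<Rightarrow> real) \<Rightarrow> ('w \<Rightarrow> 'a) \<Rightarrow> ('w set \<Rightarrow> 'a) \<Rightarrow> bool" where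
  "has_seminorm_integrals M p f I \<longleftrightarrow>
     (\<exists>fs. seminorm_approx M p f fs \<and>
        (\<forall>E\<in>sets M. (\<lambda>n. p (I E - simple_integral_on M (fs n) E)) \<longlonglongrightarrow> 0))"

lemma seminorm_approxD:
  assumes "seminorm_approx M p f fs"
  shows "simple_function M (fs n)"
    and "AE t in M. (\<lambda>n. p (fs n t - f t)) \<longlonglongrightarrow> 0"
    and "integrable M (\<lambda>t. p (fs n t - f t))"
    and "(\<lambda>n. \<integral>t. p (fs n t - f t) \<partial>M) \<longlonglongrightarrow> 0"
  using assms by (simp_all add: seminorm_approx_def)

lemma seminorm_Bochner_integrable_has_integrals:
  assumes "seminorm_Bochner_integrable M p f"
  obtains I where "has_seminorm_integrals M p f I"
proof -
  obtain fs where fs: "seminorm_approx M p f fs"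
    and x: "\<forall>E\<in>sets M. \<exists>x. (\<lambda>n. p (x - simple_integral_on M (fs n) E)) \<longlonglongrightarrow> 0"
    using assms unfolding seminorm_Bochner_integrable_def by blast
  from x have "\<exists>I. \<forall>E\<in>sets M. (\<lambda>n. p (I E - simple_integral_on M (fs n) E)) \<longlonglongrightarrow> 0"
    by (rule bchoice)
  with fs have "\<exists>I. has_seminorm_integrals M p f I"
    unfolding has_seminorm_integrals_def by blast
  then show thesis using that by blast
qed

lemma has_integrals_by_seminorm_iff:
  "has_integrals_by_seminorm T M f I \<longleftrightarrow> (\<forall>p\<in>cont_seminorms T. has_seminorm_integrals M p f I)"
  by (simp only: has_integrals_by_seminorm_def has_seminorm_integrals_def bchoice_iff)

text \<open>
  Since \<open>p \<circ> (fs n - f)\<close> is automatically measurable when it tends to \<open>0\<close> almost everywhere, a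
  majorant with the required properties yields all of them for \<open>fs\<close>.
\<close>

lemma seminorm_approxI:
  assumes M: "complete_finite_measure M" and p: "seminorm p"
    and fs: "\<And>n. simple_function M (fs n)"
    and le: "\<And>n t. p (fs n t - f t) \<le> u n t"
    and u: "AE t in M. (\<lambda>n. u n t) \<longlonglongrightarrow> 0" "\<And>n. integrable M (u n)"
      "(\<lambda>n. \<integral>t. u n t \<partial>M) \<longlonglongrightarrow> 0"
  shows "seminorm_approx M p f fs"
proof -
  have lim: "AE t in M. (\<lambda>n. p (fs n t - f t)) \<longlonglongrightarrow> 0"
    using u(1)
  proof eventually_elim
    case (elim t)
    show ?case
      by (rule real_tendsto_sandwich[OF _ _ tendsto_const elim]) (auto simp: p le)
  qed
  have int: "integrable M (\<lambda>t. p (fs n t - f t))" for n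
  proof (rule Bochner_Integration.integrable_bound[OF u(2)[of n]])
    show "(\<lambda>t. p (fs n t - f t)) \<in> borel_measurable M"
      by (rule borel_measurable_seminorm_limit[OF M p fs lim fs])
    show "AE t in M. norm (p (fs n t - f t)) \<le> norm (u n t)"
      using le[of n] p by (intro AE_I2) (simp add: order_trans[OF _ abs_ge_self])
  qed
  have "(\<lambda>n. \<integral>t. p (fs n t - f t) \<partial>M) \<longlonglongrightarrow> 0"
  proof (rule real_tendsto_sandwich[OF _ _ tendsto_const u(3)])
    show "\<forall>\<^sub>F n in sequentially. 0 \<le> (\<integral>t. p (fs n t - f t) \<partial>M)"
      using p by (intro always_eventually allI integral_nonneg_AE AE_I2) simp
    show "\<forall>\<^sub>F n in sequentially. (\<integral>t. p (fs n t - f t) \<partial>M) \<le> (\<integral>t. u n t \<partial>M)"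
      by (intro always_eventually allI integral_mono int u(2) le)
  qed
  with lim int fs show ?thesis by (simp add: seminorm_approx_def)
qed

lemma has_seminorm_integrals_mono:
  assumes M: "complete_finite_measure M" and p: "seminorm p" and pq: "p \<le> q"
    and f: "has_seminorm_integrals M q f I"
  shows "has_seminorm_integrals M p f I"
proof -
  obtain fs where fs': "seminorm_approx M q f fs"
    and I: "\<And>E. E \<in> sets M \<Longrightarrow> (\<lambda>n. q (I E - simple_integral_on M (fs n) E)) \<longlonglongrightarrow> 0"
    using f unfolding has_seminorm_integrals_def by blast
  note fs = seminorm_approxD[OF fs']
  have le: "p x \<le> q x" for x using pq by (simp add: le_fun_def)
  have "seminorm_approx M p f fs"
    by (rule seminorm_approxI[OF M p fs(1) le fs(2-4)])
  moreover have "(\<lambda>n. p (I E - simple_integral_on M (fs n) E)) \<longlonglongrightarrow> 0" if "E \<in> sets M" for E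
    by (rule real_tendsto_sandwich[OF _ _ tendsto_const I[OF that]]) (auto simp: p le)
  ultimately show ?thesis unfolding has_seminorm_integrals_def by blast
qed

lemma has_seminorm_integrals_simple:
  assumes "seminorm p" and "simple_function M g"
  shows "has_seminorm_integrals M p g (simple_integral_on M g)"
  unfolding has_seminorm_integrals_def seminorm_approx_def
  using assms by (intro exI[of _ "\<lambda>n. g"]) simp

lemma has_seminorm_integrals_diff:
  assumes M: "complete_finite_measure M" and p: "seminorm p"
    and f: "has_seminorm_integrals M p f I" and g: "has_seminorm_integrals M p g J"
  shows "has_seminorm_integrals M p (\<lambda>t. f t - g t) (\<lambda>E. I E - J E)"
proof -
  have fin: "finite_measure M" using M by (simp add: complete_finite_measure_def)
  obtain fs where fs': "seminorm_approx M p f fs"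
    and I: "\<And>E. E \<in> sets M \<Longrightarrow> (\<lambda>n. p (I E - simple_integral_on M (fs n) E)) \<longlonglongrightarrow> 0"
    using f unfolding has_seminorm_integrals_def by blast
  note fs = seminorm_approxD[OF fs']
  obtain gs where gs': "seminorm_approx M p g gs"
    and J: "\<And>E. E \<in> sets M \<Longrightarrow> (\<lambda>n. p (J E - simple_integral_on M (gs n) E)) \<longlonglongrightarrow> 0"
    using g unfolding has_seminorm_integrals_def by blast
  note gs = seminorm_approxD[OF gs']
  let ?u = "\<lambda>n t. p (fs n t - f t) + p (gs n t - g t)"
  have le: "p ((a - b) - (c - d)) \<le> p (a - c) + p (b - d)" for a b c d
    using seminorm_diff_le[OF p, of "a - c" "b - d"] by (simp add: algebra_simps)
  have simple: "simple_function M (\<lambda>t. fs n t - gs n t)" for n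
    using fs(1) gs(1) by (rule simple_function_diff)
  have "seminorm_approx M p (\<lambda>t. f t - g t) (\<lambda>n t. fs n t - gs n t)"
  proof (rule seminorm_approxI[OF M p simple le])
    show "AE t in M. (\<lambda>n. ?u n t) \<longlonglongrightarrow> 0"
      using fs(2) gs(2) by eventually_elim (rule tendsto_add_zero)
    show "integrable M (?u n)" for n
      using fs(3) gs(3) by (rule Bochner_Integration.integrable_add)
    show "(\<lambda>n. \<integral>t. ?u n t \<partial>M) \<longlonglongrightarrow> 0"
      using tendsto_add_zero[OF fs(4) gs(4)] by (simp add: fs(3) gs(3))
  qed
  moreover have "(\<lambda>n. p ((I E - J E) - simple_integral_on M (\<lambda>t. fs n t - gs n t) E)) \<longlonglongrightarrow> 0"
    if E: "E \<in> sets M" for E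
    unfolding simple_integral_on_diff[OF fin fs(1) gs(1) E]
    by (rule real_tendsto_sandwich[OF _ _ tendsto_const tendsto_add_zero[OF I[OF E] J[OF E]]])
      (auto simp: p le)
  ultimately show ?thesis unfolding has_seminorm_integrals_def by blast
qed

lemma set_integrable_of_integrable:
  fixes h :: "'w \<Rightarrow> real"
  shows "integrable M h \<Longrightarrow> E \<in> sets M \<Longrightarrow> set_integrable M E h"
  unfolding set_integrable_def by (rule integrable_mult_indicator)

lemma set_integral_le_integral:
  fixes h :: "'w \<Rightarrow> real"
  assumes "integrable M h" "E \<in> sets M" "\<And>t. 0 \<le> h t"
  shows "(LINT t:E|M. h t) \<le> (\<integral>t. h t \<partial>M)"
  unfolding set_lebesgue_integral_def
  using set_integrable_of_integrable[OF assms(1,2)] assms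
  by (intro integral_mono) (auto simp: set_integrable_def indicator_def)

text \<open>
  Both facts hold for the approximating simple functions and survive the passage to the limit, as the
  errors are at most \<open>\<integral> p (fs n - f)\<close>.
\<close>

lemma
  assumes M: "complete_finite_measure M" and p: "seminorm p"
    and f: "has_seminorm_integrals M p f I"
  shows has_seminorm_integrals_integrable: "integrable M (\<lambda>t. p (f t))"
    and has_seminorm_integrals_le: "E \<in> sets M \<Longrightarrow> p (I E) \<le> (LINT t:E|M. p (f t))"
proof -
  have fin: "finite_measure M" using M by (simp add: complete_finite_measure_def)
  obtain fs where fs': "seminorm_approx M p f fs"
    and I: "\<And>E. E \<in> sets M \<Longrightarrow> (\<lambda>n. p (I E - simple_integral_on M (fs n) E)) \<longlonglongrightarrow> 0"
    using f unfolding has_seminorm_integrals_def by blast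
  note fs = seminorm_approxD[OF fs']
  have fsint: "integrable M (\<lambda>t. p (fs n t))" for n
    by (rule integrable_simple_compose[OF fin fs(1)])
  show int: "integrable M (\<lambda>t. p (f t))"
  proof (rule Bochner_Integration.integrable_bound)
    show "integrable M (\<lambda>t. p (fs 0 t - f t) + p (fs 0 t))"
      using fs(3) fsint by (rule Bochner_Integration.integrable_add)
    show "(\<lambda>t. p (f t)) \<in> borel_measurable M"
      using borel_measurable_seminorm_limit[OF M p fs(1,2), of "\<lambda>_. 0"]
      by (simp add: seminorm_uminus[OF p])
    show "AE t in M. norm (p (f t)) \<le> norm (p (fs 0 t - f t) + p (fs 0 t))"
      using seminorm_le_diff[OF p] seminorm_minus_commute[OF p] p by (intro AE_I2) (simp add: p)
  qed
  assume E: "E \<in> sets M"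
  have "p (I E) \<le> p (I E - simple_integral_on M (fs n) E) +
      ((LINT t:E|M. p (f t)) + (\<integral>t. p (fs n t - f t) \<partial>M))" for n
  proof -
    have "p (I E) \<le> p (I E - simple_integral_on M (fs n) E) + p (simple_integral_on M (fs n) E)"
      by (rule seminorm_le_diff[OF p])
    also have "p (simple_integral_on M (fs n) E) \<le> (LINT t:E|M. p (fs n t))"
      by (rule seminorm_simple_integral_le[OF p fin fs(1) E])
    also have "\<dots> \<le> (LINT t:E|M. p (f t) + p (fs n t - f t))"
      using seminorm_le_diff[OF p]
      by (intro set_integral_mono set_integrable_of_integrable E fsint set_integral_add int fs(3))
        (simp add: add.commute)
    also have "\<dots> = (LINT t:E|M. p (f t)) + (LINT t:E|M. p (fs n t - f t))"
      by (intro set_integral_add set_integrable_of_integrable E int fs(3))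
    also have "(LINT t:E|M. p (fs n t - f t)) \<le> (\<integral>t. p (fs n t - f t) \<partial>M)"
      by (intro set_integral_le_integral fs(3) E) (simp add: p)
    finally show ?thesis by simp
  qed
  moreover have "(\<lambda>n. p (I E - simple_integral_on M (fs n) E) +
      ((LINT t:E|M. p (f t)) + (\<integral>t. p (fs n t - f t) \<partial>M))) \<longlonglongrightarrow>
      0 + ((LINT t:E|M. p (f t)) + 0)"
    by (intro tendsto_add tendsto_const I E fs(4))
  ultimately have "p (I E) \<le> 0 + ((LINT t:E|M. p (f t)) + 0)"
    by (intro LIMSEQ_le_const) auto
  then show "p (I E) \<le> (LINT t:E|M. p (f t))" by simp
qed

lemma has_seminorm_integrals_Un:
  assumes M: "complete_finite_measure M" and p: "seminorm p"
    and f: "has_seminorm_integrals M p f I"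
    and E: "E \<in> sets M" "F \<in> sets M" "E \<inter> F = {}"
  shows "p (I (E \<union> F) - (I E + I F)) = 0"
proof -
  have fin: "finite_measure M" using M by (simp add: complete_finite_measure_def)
  obtain fs where fs': "seminorm_approx M p f fs"
    and I: "\<And>E. E \<in> sets M \<Longrightarrow> (\<lambda>n. p (I E - simple_integral_on M (fs n) E)) \<longlonglongrightarrow> 0"
    using f unfolding has_seminorm_integrals_def by blast
  note fs = seminorm_approxD[OF fs']
  let ?S = "\<lambda>n. simple_integral_on M (fs n)"
  have "p (I (E \<union> F) - (I E + I F)) \<le>
      p (I (E \<union> F) - ?S n (E \<union> F)) + (p (I E - ?S n E) + p (I F - ?S n F))" for n
  proof -
    have "p (I (E \<union> F) - (I E + I F)) =
        p ((I (E \<union> F) - ?S n (E \<union> F)) - ((I E - ?S n E) + (I F - ?S n F)))"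
      by (simp add: simple_integral_on_Un[OF fin fs(1) E])
    then show ?thesis
      using seminorm_diff_le[OF p, of "I (E \<union> F) - ?S n (E \<union> F)" "(I E - ?S n E) + (I F - ?S n F)"]
        seminorm_triangle[OF p, of "I E - ?S n E" "I F - ?S n F"]
      by linarith
  qed
  moreover have "(\<lambda>n. p (I (E \<union> F) - ?S n (E \<union> F)) + (p (I E - ?S n E) + p (I F - ?S n F)))
      \<longlonglongrightarrow> 0"
    using E by (intro tendsto_add_zero I) auto
  ultimately have "p (I (E \<union> F) - (I E + I F)) \<le> 0"
    by (intro LIMSEQ_le_const) auto
  then show ?thesis using seminorm_nonneg[OF p] by (intro antisym)
qed

text \<open>
  If all integrals of \<open>f\<close> are \<open>p\<close>-null, then those of a simple approximant \<open>g\<close> satisfy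
  \<open>p (\<integral>\<^bsub>E\<^esub> g) \<le> \<integral>\<^bsub>E\<^esub> p (g - f)\<close>. On a level set \<open>E\<close> of \<open>g\<close> the left side equals \<open>\<integral>\<^bsub>E\<^esub> p g\<close>. Summing over the
  level sets gives \<open>\<integral> p g \<le> \<integral> p (g - f)\<close>, hence \<open>\<integral> p f \<le> 2 \<integral> p (g - f)\<close>, and the right side is
  arbitrarily small.
\<close>

lemma has_seminorm_integrals_zero:
  assumes M: "complete_finite_measure M" and p: "seminorm p"
    and f: "has_seminorm_integrals M p f I" and zero: "\<And>E. E \<in> sets M \<Longrightarrow> p (I E) = 0"
  shows "(\<integral>t. p (f t) \<partial>M) = 0"
proof -
  have fin: "finite_measure M" using M by (simp add: complete_finite_measure_def)
  obtain fs where fs': "seminorm_approx M p f fs"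
    and I: "\<And>E. E \<in> sets M \<Longrightarrow> (\<lambda>n. p (I E - simple_integral_on M (fs n) E)) \<longlonglongrightarrow> 0"
    using f unfolding has_seminorm_integrals_def by blast
  note fs = seminorm_approxD[OF fs']
  have int: "integrable M (\<lambda>t. p (f t))"
    by (rule has_seminorm_integrals_integrable[OF M p f])
  have bound: "(\<integral>t. p (f t) \<partial>M) \<le> 2 * (\<integral>t. p (fs n t - f t) \<partial>M)" for n
  proof -
    let ?d = "\<lambda>t. p (fs n t - f t)"
    let ?L = "\<lambda>x. fs n -` {x} \<inter> space M"
    have L: "?L x \<in> sets M" for x using fs(1) by (rule simple_functionD)
    have finv: "finite (fs n ` space M)" using fs(1)[of n] by (simp add: simple_function_def)
    have fsint: "integrable M (\<lambda>t. p (fs n t))"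
      by (rule integrable_simple_compose[OF fin fs(1)])
    have diff: "has_seminorm_integrals M p (\<lambda>t. fs n t - f t) (\<lambda>E. simple_integral_on M (fs n) E - I E)"
      by (rule has_seminorm_integrals_diff[OF M p has_seminorm_integrals_simple[OF p fs(1)] f])
    have S: "p (simple_integral_on M (fs n) E) \<le> (LINT t:E|M. ?d t)" if E: "E \<in> sets M" for E
      using has_seminorm_integrals_le[OF M p diff E] zero[OF E]
        seminorm_le_diff[OF p, of "simple_integral_on M (fs n) E" "I E"] by simp
    have single: "simple_integral_on M (fs n) (?L x) = measure M (?L x) *\<^sub>R x"
      if x: "x \<in> fs n ` space M" for x
    proof -
      have "simple_integral_on M (fs n) (?L x) =
          (\<Sum>y\<in>fs n ` space M. if y = x then measure M (?L x) *\<^sub>R x else 0)"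
        unfolding simple_integral_on_def
      proof (intro sum.cong refl)
        fix y
        have "?L x \<inter> ?L y = (if y = x then ?L x else {})" by auto
        then show "measure M (?L x \<inter> ?L y) *\<^sub>R y = (if y = x then measure M (?L x) *\<^sub>R x else 0)"
          by simp
      qed
      then show ?thesis using finv x by simp
    qed
    have "(LINT t:space M|M. p (fs n t)) = (\<Sum>x\<in>fs n ` space M. measure M (?L x) * p x)"
      unfolding set_integral_simple_compose[OF fin fs(1) sets.top]
      by (intro sum.cong refl arg_cong2[where f = "(*)"] arg_cong[where f = "measure M"]) auto
    also have "\<dots> = (\<Sum>x\<in>fs n ` space M. p (simple_integral_on M (fs n) (?L x)))"
      by (intro sum.cong refl) (simp add: single seminorm_scaleR[OF p])
    also have "\<dots> \<le> (\<Sum>x\<in>fs n ` space M. (LINT t:?L x|M. ?d t))"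
      by (intro sum_mono S L)
    also have "\<dots> = (LINT t:(\<Union>x\<in>fs n ` space M. ?L x)|M. ?d t)"
      using finv L fs(3)[of n]
      by (intro set_integral_finite_Union[symmetric])
        (auto simp: disjoint_family_on_def intro!: set_integrable_of_integrable)
    also have "\<dots> \<le> (\<integral>t. ?d t \<partial>M)"
    proof (rule set_integral_le_integral[OF fs(3)])
      show "(\<Union>x\<in>fs n ` space M. ?L x) \<in> sets M" using finv L by (rule sets.finite_UN)
    qed (simp add: p)
    finally have 1: "(\<integral>t. p (fs n t) \<partial>M) \<le> (\<integral>t. ?d t \<partial>M)"
      by (simp add: set_integral_space[OF fsint])
    have "(\<integral>t. p (f t) \<partial>M) \<le> (\<integral>t. ?d t + p (fs n t) \<partial>M)"
      using seminorm_le_diff[OF p] seminorm_minus_commute[OF p]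
      by (intro integral_mono int Bochner_Integration.integrable_add fs(3) fsint) simp
    also have "\<dots> = (\<integral>t. ?d t \<partial>M) + (\<integral>t. p (fs n t) \<partial>M)"
      by (intro Bochner_Integration.integral_add fs(3) fsint)
    finally show ?thesis using 1 by simp
  qed
  have "(\<lambda>n. 2 * (\<integral>t. p (fs n t - f t) \<partial>M)) \<longlonglongrightarrow> 0"
    using tendsto_mult_right_zero[OF fs(4)] .
  then have "(\<integral>t. p (f t) \<partial>M) \<le> 0"
    by (rule LIMSEQ_le_const) (use bound in blast)
  moreover have "0 \<le> (\<integral>t. p (f t) \<partial>M)" by (intro integral_nonneg_AE AE_I2) (simp add: p)
  ultimately show ?thesis by simp
qed

section \<open>Continuous seminorms determine a locally convex topology\<close>

lemma hausdorff_lcs_topspace [simp]: "hausdorff_lcs T \<Longrightarrow> topspace T = UNIV"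
  by (simp add: hausdorff_lcs_def)

lemma cont_seminorms_seminorm: "p \<in> cont_seminorms T \<Longrightarrow> seminorm p"
  by (simp add: cont_seminorms_def)

lemma cont_seminorms_zero: "(\<lambda>_. 0) \<in> cont_seminorms T"
  by (simp add: cont_seminorms_def seminorm_def)

lemma cont_seminorms_add:
  "p \<in> cont_seminorms T \<Longrightarrow> q \<in> cont_seminorms T \<Longrightarrow> (\<lambda>x. p x + q x) \<in> cont_seminorms T"
  unfolding cont_seminorms_def seminorm_def
  by (auto intro!: continuous_map_add simp: algebra_simps) (metis add.assoc add.left_commute add_mono)

lemma continuous_map_affine:
  assumes T: "hausdorff_lcs T"
  shows "continuous_map T T (\<lambda>x. c *\<^sub>R (x + a))"
proof -
  have add: "continuous_map (prod_topology T T) T (\<lambda>(x, y). x + y)"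
    and scale: "continuous_map (prod_topology euclideanreal T) T (\<lambda>(c, x). c *\<^sub>R x)"
    using T by (auto simp: hausdorff_lcs_def)
  have "continuous_map T (prod_topology T T) (\<lambda>x. (x, a))"
    using T by (intro continuous_map_pairedI) auto
  from continuous_map_compose[OF this add] have "continuous_map T T (\<lambda>x. x + a)"
    by (simp add: o_def)
  then have "continuous_map T (prod_topology euclideanreal T) (\<lambda>x. (c, x + a))"
    by (intro continuous_map_pairedI) auto
  from continuous_map_compose[OF this scale] show ?thesis by (simp add: o_def)
qed

lemma openin_affine_vimage:
  assumes T: "hausdorff_lcs T" and U: "openin T U"
  shows "openin T {x. c *\<^sub>R (x + a) \<in> U}"
  using openin_continuous_map_preimage[OF continuous_map_affine[OF T] U] T by simp

lemma continuous_map_scaleR_left: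
  assumes T: "hausdorff_lcs T"
  shows "continuous_map euclideanreal T (\<lambda>c. c *\<^sub>R x)"
proof -
  have scale: "continuous_map (prod_topology euclideanreal T) T (\<lambda>(c, x). c *\<^sub>R x)"
    using T by (auto simp: hausdorff_lcs_def)
  have "continuous_map euclideanreal (prod_topology euclideanreal T) (\<lambda>c. (c, x))"
    using T by (intro continuous_map_pairedI) auto
  from continuous_map_compose[OF this scale] show ?thesis by (simp add: o_def)
qed

text \<open>
  The Minkowski functional of a convex neighbourhood of \<open>0\<close>, made symmetric, is a continuous seminorm.
\<close>

lemma exists_cont_seminorm_ball_subset:
  assumes T: "hausdorff_lcs T" and U: "openin T U" "0 \<in> U"
  obtains p where "p \<in> cont_seminorms T" "\<And>x. p x < 1 \<Longrightarrow> x \<in> U"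
proof -
  obtain V where V: "openin T V" "0 \<in> V" "convex V" "V \<subseteq> U"
    using T U by (auto simp: hausdorff_lcs_def)
  \<comment> \<open>Intersecting with the reflection yields symmetry, and with it homogeneity for negative scalars.\<close>
  define W where "W = {x. x \<in> V \<and> - x \<in> V}"
  have "W = V \<inter> {x. (-1) *\<^sub>R (x + 0) \<in> V}" by (auto simp: W_def)
  then have W: "openin T W"
    using openin_affine_vimage[OF T V(1), of "-1" 0] V(1) by (simp add: openin_Int)
  have W0: "0 \<in> W" using V by (simp add: W_def)
  have Wconv: "u *\<^sub>R x + v *\<^sub>R y \<in> W" if "x \<in> W" "y \<in> W" "0 \<le> u" "0 \<le> v" "u + v = 1" for x y u v
    using that convexD[OF V(3), of x y u v] convexD[OF V(3), of "- x" "- y" u v] by (simp add: W_def)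
  define S where "S = (\<lambda>x. {r. r > 0 \<and> inverse r *\<^sub>R x \<in> W})"
  define p where "p = (\<lambda>x. Inf (S x))"
  \<comment> \<open>Neighbourhoods of \<open>0\<close> are absorbing, because scalar multiplication is continuous at \<open>(0, x)\<close>.\<close>
  have ne: "S x \<noteq> {}" for x
  proof -
    have "open {c. c *\<^sub>R x \<in> W}"
      using openin_continuous_map_preimage[OF continuous_map_scaleR_left[OF T] W, of x] by simp
    moreover have "0 \<in> {c. c *\<^sub>R x \<in> W}" using W0 by simp
    ultimately obtain e where e: "e > 0" "ball 0 e \<subseteq> {c. c *\<^sub>R x \<in> W}"
      by (meson open_contains_ball)
    then have "e / 2 \<in> {c. c *\<^sub>R x \<in> W}" by (intro subsetD[OF e(2)]) auto
    then have "inverse (e / 2) \<in> S x" using e(1) by (simp add: S_def)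
    then show ?thesis by blast
  qed
  have bdd: "bdd_below (S x)" for x by (rule bdd_belowI[of _ 0]) (simp add: S_def)
  have le: "p x \<le> r" if "r \<in> S x" for r x
    unfolding p_def using that bdd by (rule cInf_lower)
  have ge: "a \<le> p x" if "\<And>r. r \<in> S x \<Longrightarrow> a \<le> r" for a x
    unfolding p_def using that by (intro cInf_greatest ne)
  have nonneg: "0 \<le> p x" for x by (rule ge) (simp add: S_def)
  have add: "p (x + y) \<le> p x + p y" for x y
  proof -
    have "r + s \<in> S (x + y)" if r: "r \<in> S x" and s: "s \<in> S y" for r s
    proof -
      have rs: "r > 0" "s > 0" using r s by (auto simp: S_def)
      have "(r / (r + s)) *\<^sub>R (inverse r *\<^sub>R x) + (s / (r + s)) *\<^sub>R (inverse s *\<^sub>R y) \<in> W"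
        using r s rs by (intro Wconv) (auto simp: S_def add_divide_distrib[symmetric])
      moreover have "(r / (r + s)) *\<^sub>R (inverse r *\<^sub>R x) + (s / (r + s)) *\<^sub>R (inverse s *\<^sub>R y) =
          inverse (r + s) *\<^sub>R (x + y)"
        using rs by (simp add: scaleR_add_right field_simps)
      ultimately show ?thesis using rs by (simp add: S_def)
    qed
    then have "p (x + y) - s \<le> p x" if "s \<in> S y" for s
      using that le by (intro ge) (force simp: algebra_simps)
    then have "p (x + y) - p x \<le> p y"
      by (intro ge) (force simp: algebra_simps)
    then show ?thesis by simp
  qed
  have scale_le: "p (c *\<^sub>R x) \<le> c * p x" if c: "c > 0" for c x
  proof -
    have "p (c *\<^sub>R x) / c \<le> p x"
    proof (rule ge)
      fix r assume "r \<in> S x"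
      moreover have "inverse (c * r) *\<^sub>R (c *\<^sub>R x) = inverse r *\<^sub>R x" using c by simp
      ultimately have "c * r \<in> S (c *\<^sub>R x)"
        unfolding S_def mem_Collect_eq using c by (metis mult_pos_pos)
      from le[OF this] show "p (c *\<^sub>R x) / c \<le> r" using c by (simp add: field_simps)
    qed
    then show ?thesis using c by (simp add: field_simps)
  qed
  have scale_pos: "p (c *\<^sub>R x) = c * p x" if c: "c > 0" for c x
  proof (rule antisym[OF scale_le[OF c]])
    show "c * p x \<le> p (c *\<^sub>R x)"
      using scale_le[of "inverse c" "c *\<^sub>R x"] c by (simp add: field_simps)
  qed
  have "S (- x) = S x" for x by (auto simp: S_def W_def)
  then have neg: "p (- x) = p x" for x by (simp add: p_def)
  have p0: "p 0 = 0" using scale_pos[of 2 0] by simp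
  have "p (c *\<^sub>R x) = \<bar>c\<bar> * p x" for c x
  proof (cases c "0 :: real" rule: linorder_cases)
    case less
    then show ?thesis using scale_pos[of "- c" x] neg[of "c *\<^sub>R x"] by simp
  qed (simp_all add: p0 scale_pos)
  then have p: "seminorm p" using add by (simp add: seminorm_def)
  have "continuous_map T euclideanreal p"
    unfolding continuous_map_atin limitin_canonical_iff
  proof (intro ballI tendstoI)
    fix x and e :: real assume e: "e > 0"
    let ?N = "{y. inverse (e / 2) *\<^sub>R (y + (- x)) \<in> W}"
    have "dist (p y) (p x) < e" if "y \<in> ?N" for y
    proof -
      have "e / 2 \<in> S (y - x)" using that e by (simp add: S_def)
      then have "p (y - x) \<le> e / 2" by (rule le)
      then show ?thesis
        using seminorm_reverse_triangle[OF p, of y x] e by (simp add: dist_real_def)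
    qed
    moreover have "openin T ?N" by (rule openin_affine_vimage[OF T W])
    moreover have "x \<in> ?N" using W0 by simp
    ultimately show "\<forall>\<^sub>F y in atin T x. dist (p y) (p x) < e"
      unfolding eventually_atin by blast
  qed
  moreover have "x \<in> U" if x: "p x < 1" for x
  proof -
    obtain r where r: "r \<in> S x" "r < 1"
      using x ge[of x 1] by force
    have "r *\<^sub>R (inverse r *\<^sub>R x) + (1 - r) *\<^sub>R 0 \<in> W"
      using r W0 by (intro Wconv) (auto simp: S_def)
    then have "x \<in> W" using r by (simp add: S_def)
    then show ?thesis using V by (auto simp: W_def)
  qed
  ultimately show thesis using p by (intro that[of p]) (auto simp: cont_seminorms_def)
qed

lemma limitin_iff_cont_seminorms:
  assumes T: "hausdorff_lcs T"
  shows "limitin T f l F \<longleftrightarrow> (\<forall>p\<in>cont_seminorms T. ((\<lambda>x. p (f x - l)) \<longlongrightarrow> 0) F)"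
proof safe
  fix p assume lim: "limitin T f l F" and p: "p \<in> cont_seminorms T"
  have "continuous_map T T (\<lambda>x. 1 *\<^sub>R (x + - l))" by (rule continuous_map_affine[OF T])
  then have "continuous_map T euclideanreal (p \<circ> (\<lambda>x. x - l))"
    using p by (intro continuous_map_compose) (auto simp: cont_seminorms_def)
  from continuous_map_limit[OF this lim]
  show "((\<lambda>x. p (f x - l)) \<longlongrightarrow> 0) F"
    using cont_seminorms_seminorm[OF p] by (simp add: o_def)
next
  assume lim: "\<forall>p\<in>cont_seminorms T. ((\<lambda>x. p (f x - l)) \<longlongrightarrow> 0) F"
  show "limitin T f l F"
    unfolding limitin_def
  proof (intro conjI allI impI)
    fix U assume U: "openin T U \<and> l \<in> U"
    have "openin T {x. 1 *\<^sub>R (x + l) \<in> U}"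
      using U by (intro openin_affine_vimage[OF T]) auto
    then obtain p where p: "p \<in> cont_seminorms T" "\<And>x. p x < 1 \<Longrightarrow> x \<in> {x. 1 *\<^sub>R (x + l) \<in> U}"
      using exists_cont_seminorm_ball_subset[OF T] U by (metis (no_types, lifting) add_0 mem_Collect_eq scaleR_one)
    have "\<forall>\<^sub>F x in F. p (f x - l) < 1"
      using lim p(1) by (intro order_tendstoD(2)[where y = 0]) auto
    then show "\<forall>\<^sub>F x in F. f x \<in> U"
      by eventually_elim (use p(2) in force)
  qed (use T in simp)
qed

lemma cont_seminorms_separate:
  assumes T: "hausdorff_lcs T" and zero: "\<And>p. p \<in> cont_seminorms T \<Longrightarrow> p x = 0"
  shows "x = 0"
proof (rule ccontr)
  assume "x \<noteq> 0"
  then obtain U V where UV: "openin T U" "0 \<in> U" "x \<in> V" "disjnt U V"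
    using T unfolding hausdorff_lcs_def Hausdorff_space_def by (metis UNIV_I)
  obtain p where p: "p \<in> cont_seminorms T" "\<And>x. p x < 1 \<Longrightarrow> x \<in> U"
    using exists_cont_seminorm_ball_subset[OF T UV(1,2)] by blast
  have "x \<in> U" by (rule p(2)) (simp add: zero[OF p(1)])
  with UV show False by (auto simp: disjnt_iff)
qed

text \<open>
  Completeness is formulated with Cauchy filters. The sets of vectors that \<open>p\<close> cannot distinguish
  from \<open>x p\<close> form a filter base: as the sum \<open>p + q\<close> of two seminorms dominates both, the set
  of \<open>p + q\<close> is contained in those of \<open>p\<close> and \<open>q\<close>. The base is Cauchy because \<open>p (y - z) = 0\<close> for any two
  members \<open>y\<close>, \<open>z\<close> of the set of \<open>p\<close>.
\<close>

lemma complete_lcs_net_limit: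
  assumes T: "complete_lcs T"
    and net: "\<And>p q. p \<in> cont_seminorms T \<Longrightarrow> q \<in> cont_seminorms T \<Longrightarrow> p \<le> q \<Longrightarrow> p (x p - x q) = 0"
  obtains l where "\<And>p. p \<in> cont_seminorms T \<Longrightarrow> p (l - x p) = 0"
proof -
  have lcs: "hausdorff_lcs T" using T by (simp add: complete_lcs_def)
  let ?S = "cont_seminorms T"
  define K where "K = (\<lambda>p. {y. p (y - x p) = 0})"
  define F where "F = (INF p\<in>?S. principal (K p))"
  have base: "eventually P F \<longleftrightarrow> (\<exists>p\<in>?S. \<forall>y\<in>K p. P y)" for P
    unfolding F_def
  proof (subst eventually_INF_base)
    show "?S \<noteq> {}" using cont_seminorms_zero by blast
    fix a b assume ab: "a \<in> ?S" "b \<in> ?S"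
    let ?c = "\<lambda>x. a x + b x"
    have sem: "seminorm a" "seminorm b" using ab by (auto dest: cont_seminorms_seminorm)
    have c: "?c \<in> ?S" using ab by (rule cont_seminorms_add)
    have "K ?c \<subseteq> K r" if r: "r \<in> ?S" "r \<le> ?c" for r
    proof
      fix y assume "y \<in> K ?c"
      then have "r (y - x ?c) \<le> 0" using r(2) by (metis (mono_tags) K_def le_funD mem_Collect_eq)
      moreover have "r (x ?c - x r) = 0"
        using net[OF r(1) c r(2)] seminorm_minus_commute[OF cont_seminorms_seminorm[OF r(1)]] by metis
      moreover note cont_seminorms_seminorm[OF r(1)]
      ultimately show "y \<in> K r"
        using seminorm_diff_triangle[of r y "x r" "x ?c"] seminorm_nonneg[of r "y - x r"]
        unfolding K_def mem_Collect_eq by linarith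
    qed
    moreover have "a \<le> ?c" "b \<le> ?c" using sem by (auto simp: le_fun_def)
    ultimately show "\<exists>c\<in>?S. principal (K c) \<le> inf (principal (K a)) (principal (K b))"
      using ab c by (intro bexI[of _ ?c]) auto
  qed (simp add: eventually_principal)
  have "lcs_cauchy_filter T F"
    unfolding lcs_cauchy_filter_def
  proof (intro conjI allI impI)
    have "x p \<in> K p" if "p \<in> ?S" for p
      using cont_seminorms_seminorm[OF that] by (simp add: K_def)
    then show "F \<noteq> bot"
      unfolding trivial_limit_def base by blast
    fix U assume "openin T U \<and> 0 \<in> U"
    then obtain p where p: "p \<in> ?S" "\<And>x. p x < 1 \<Longrightarrow> x \<in> U"
      using exists_cont_seminorm_ball_subset[OF lcs] by blast
    note sem = cont_seminorms_seminorm[OF p(1)]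
    have "y - z \<in> U" if "y \<in> K p" "z \<in> K p" for y z
      using that seminorm_diff_triangle[OF sem, of y z "x p"] seminorm_minus_commute[OF sem, of z "x p"]
      by (intro p(2)) (simp add: K_def)
    moreover have "eventually (\<lambda>y. y \<in> K p) F" using p(1) by (auto simp: base)
    ultimately show "\<forall>\<^sub>F (y, z) in F \<times>\<^sub>F F. y - z \<in> U"
      unfolding eventually_prod_filter by (intro exI[of _ "\<lambda>y. y \<in> K p"]) auto
  qed
  then obtain l where l: "limitin T (\<lambda>y. y) l F"
    using T by (auto simp: complete_lcs_def)
  have "p (l - x p) = 0" if p: "p \<in> ?S" for p
  proof -
    note sem = cont_seminorms_seminorm[OF p]
    have "F \<noteq> bot" using \<open>lcs_cauchy_filter T F\<close> by (simp add: lcs_cauchy_filter_def)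
    moreover have "((\<lambda>y. p (y - l)) \<longlongrightarrow> 0) F"
      using l p by (simp add: limitin_iff_cont_seminorms[OF lcs])
    moreover have "eventually (\<lambda>y. p (l - x p) \<le> p (y - l)) F"
    proof -
      have "p (l - x p) \<le> p (y - l)" if "y \<in> K p" for y
        using that seminorm_diff_triangle[OF sem, of l "x p" y] seminorm_minus_commute[OF sem, of l y]
        by (simp add: K_def)
      then show ?thesis using p by (auto simp: base)
    qed
    ultimately have "p (l - x p) \<le> 0"
      by (intro tendsto_lowerbound) auto
    then show ?thesis using seminorm_nonneg[OF sem] by (intro antisym)
  qed
  then show thesis by (rule that)
qed

section \<open>Dominated vector measures\<close>

text \<open>
  For each seminorm the domination reduces every claim to the corresponding one about the
  finite measure \<open>E \<mapsto> \<integral>\<^bsub>E\<^esub> h\<close>. Countable additivity comes from the fact that the remainders of a disjoint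
  union decrease to the empty set.
\<close>

lemma dominated_vector_measure:
  assumes T: "hausdorff_lcs T"
    and add: "\<And>E F. E \<in> sets M \<Longrightarrow> F \<in> sets M \<Longrightarrow> E \<inter> F = {} \<Longrightarrow> m (E \<union> F) = m E + m F"
    and dom: "\<And>p. p \<in> cont_seminorms T \<Longrightarrow>
      \<exists>h. integrable M h \<and> (\<forall>t. 0 \<le> h t) \<and> (\<forall>E\<in>sets M. p (m E) \<le> (LINT t:E|M. h t))"
  shows "vector_measure T M m" and "of_bounded_variation T M m" and "absolutely_continuous_vm M m"
proof -
  have m0: "m {} = 0" using add[of "{}" "{}"] by simp
  have sum: "m (\<Union>i<n. A i) = (\<Sum>i<n. m (A i))"
    if A: "range A \<subseteq> sets M" "disjoint_family A" for A :: "nat \<Rightarrow> _" and n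
  proof (induction n)
    case (Suc n)
    have "m ((\<Union>i<n. A i) \<union> A n) = m (\<Union>i<n. A i) + m (A n)"
    proof (rule add)
      have "A i \<inter> A n = {}" if "i < n" for i
        using A(2) that by (simp add: disjoint_family_on_def)
      then show "(\<Union>i<n. A i) \<inter> A n = {}" by blast
    qed (use A(1) in auto)
    then show ?case using Suc by (simp add: lessThan_Suc Un_commute)
  qed (simp add: m0)
  show "vector_measure T M m"
    unfolding vector_measure_def limitin_iff_cont_seminorms[OF T]
  proof (intro allI impI ballI, elim conjE)
    fix A :: "nat \<Rightarrow> 'b set" and p
    assume A: "range A \<subseteq> sets M" "disjoint_family A" and p: "p \<in> cont_seminorms T"
    note sem = cont_seminorms_seminorm[OF p]
    obtain h where h: "integrable M h" "\<And>t. 0 \<le> h t"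
      "\<And>E. E \<in> sets M \<Longrightarrow> p (m E) \<le> (LINT t:E|M. h t)"
      using dom[OF p] by blast
    \<comment> \<open>The remainders of the union: by finite additivity the error of the partial sums is \<open>m (R n)\<close>.\<close>
    define R where "R = (\<lambda>n. (\<Union>i. A i) - (\<Union>i<n. A i))"
    have R: "R n \<in> sets M" for n using A(1) unfolding R_def by (intro sets.Diff sets.countable_UN sets.finite_UN) auto
    have "(\<Inter>n. R n) = {}" by (auto simp: R_def)
    moreover have "decseq R" unfolding R_def by (intro decseq_SucI) (auto simp: lessThan_Suc)
    ultimately have lim: "(\<lambda>n. LINT t:R n|M. h t) \<longlonglongrightarrow> 0"
      using set_integral_cont_down[of R M h, OF R] set_integrable_of_integrable[OF h(1) R]
      by (simp add: set_lebesgue_integral_def)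
    have "p ((\<Sum>i<n. m (A i)) - m (\<Union>i. A i)) \<le> (LINT t:R n|M. h t)" for n
    proof -
      have "m ((\<Union>i<n. A i) \<union> R n) = m (\<Union>i<n. A i) + m (R n)"
        using A(1) by (intro add R) (auto simp: R_def)
      moreover have "(\<Union>i<n. A i) \<union> R n = (\<Union>i. A i)" by (auto simp: R_def)
      ultimately have "p ((\<Sum>i<n. m (A i)) - m (\<Union>i. A i)) = p (m (R n))"
        using sum[OF A, of n] seminorm_uminus[OF sem, of "m (R n)"] by simp
      then show ?thesis using h(3)[OF R] by simp
    qed
    then show "(\<lambda>n. p ((\<Sum>i<n. m (A i)) - m (\<Union>i. A i))) \<longlonglongrightarrow> 0"
      by (intro real_tendsto_sandwich[OF _ _ tendsto_const lim]) (auto simp: sem)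
  qed
  show "of_bounded_variation T M m"
    unfolding of_bounded_variation_def
  proof
    fix p assume p: "p \<in> cont_seminorms T"
    obtain h where h: "integrable M h" "\<And>t. 0 \<le> h t"
      "\<And>E. E \<in> sets M \<Longrightarrow> p (m E) \<le> (LINT t:E|M. h t)"
      using dom[OF p] by blast
    show "bdd_above {\<Sum>A\<in>\<pi>. p (m A) |\<pi>. finite \<pi> \<and> \<pi> \<subseteq> sets M \<and> partition_on (space M) \<pi>}"
    proof (rule bdd_aboveI)
      fix v assume "v \<in> {\<Sum>A\<in>\<pi>. p (m A) |\<pi>. finite \<pi> \<and> \<pi> \<subseteq> sets M \<and> partition_on (space M) \<pi>}"
      then obtain \<pi> where v: "v = (\<Sum>A\<in>\<pi>. p (m A))"
        and \<pi>: "finite \<pi>" "\<pi> \<subseteq> sets M" "partition_on (space M) \<pi>" by blast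
      have "v \<le> (\<Sum>A\<in>\<pi>. LINT t:A|M. h t)"
        unfolding v using \<pi>(2) by (intro sum_mono h(3)) auto
      also have "\<dots> = (LINT t:(\<Union>A\<in>\<pi>. A)|M. h t)"
        using \<pi> h(1)
        by (intro set_integral_finite_Union[symmetric] set_integrable_of_integrable)
          (auto simp: partition_on_def disjoint_family_on_def disjoint_def)
      also have "\<dots> \<le> (\<integral>t. h t \<partial>M)"
        using \<pi>(1,2) h(1,2) by (intro set_integral_le_integral) auto
      finally show "v \<le> (\<integral>t. h t \<partial>M)" .
    qed
  qed
  show "absolutely_continuous_vm M m"
    unfolding absolutely_continuous_vm_def
  proof (intro ballI cont_seminorms_separate[OF T])
    fix Z p assume Z: "Z \<in> null_sets M" and p: "p \<in> cont_seminorms T"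
    obtain h where h: "\<And>E. E \<in> sets M \<Longrightarrow> p (m E) \<le> (LINT t:E|M. h t)"
      using dom[OF p] by blast
    have "(LINT t:Z|M. h t) = 0"
      unfolding set_lebesgue_integral_def
      by (rule integral_eq_zero_AE) (use AE_not_in[OF Z] in eventually_elim, simp)
    then show "p (m Z) = 0"
      using h[of Z] Z seminorm_nonneg[OF cont_seminorms_seminorm[OF p], of "m Z"] by auto
  qed
qed

section \<open>Moving measure spaces into the universe\<close>

lemma complete_finite_measure_embed_measure:
  assumes j: "inj j" and M: "complete_finite_measure M"
  shows "complete_finite_measure (embed_measure M j)"
proof -
  interpret finite_measure M using M by (simp add: complete_finite_measure_def)
  interpret complete_measure M using M by (simp add: complete_finite_measure_def)
  have "complete_measure (embed_measure M j)"
  proof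
    fix A B assume B: "B \<subseteq> A" and A: "A \<in> null_sets (embed_measure M j)"
    then obtain A' where A': "A = j ` A'" "A' \<in> sets M"
      by (auto simp: null_sets_def sets_embed_measure[OF j])
    then have "A' \<in> null_sets M"
      using A by (auto simp: null_sets_def emeasure_embed_measure_image[OF j])
    moreover have "j -` B \<subseteq> A'" using B A' j by (auto dest: injD)
    ultimately have "j -` B \<in> sets M" using complete by blast
    moreover have "B = j ` (j -` B)" using B A' by auto
    ultimately show "B \<in> sets (embed_measure M j)"
      using in_sets_embed_measure by metis
  qed
  moreover have "finite_measure (embed_measure M j)"
    by (rule finite_measureI)
      (simp add: space_embed_measure emeasure_embed_measure_image[OF j])
  ultimately show ?thesis by (simp add: complete_finite_measure_def)
qed

lemma simple_integral_on_embed_measure: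
  assumes j: "inj j" and g: "simple_function (embed_measure M j) g" and E: "E \<in> sets M"
  shows "simple_integral_on M (\<lambda>t. g (j t)) E = simple_integral_on (embed_measure M j) g (j ` E)"
proof -
  let ?N = "embed_measure M j"
  have "measure M (E \<inter> ((\<lambda>t. g (j t)) -` {x} \<inter> space M)) =
      measure ?N (j ` E \<inter> (g -` {x} \<inter> space ?N))" for x
  proof -
    have "g -` {x} \<inter> space ?N \<in> sets ?N" using g by (rule simple_functionD)
    then have "j -` (g -` {x} \<inter> space ?N) \<inter> space M \<in> sets M"
      using measurable_embed_measure2[OF j] measurable_sets by blast
    moreover have "j -` (g -` {x} \<inter> space ?N) \<inter> space M = (\<lambda>t. g (j t)) -` {x} \<inter> space M"
      by (auto simp: space_embed_measure)
    ultimately have "E \<inter> ((\<lambda>t. g (j t)) -` {x} \<inter> space M) \<in> sets M"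
      using E by auto
    moreover have "j ` (E \<inter> ((\<lambda>t. g (j t)) -` {x} \<inter> space M)) = j ` E \<inter> (g -` {x} \<inter> space ?N)"
      using j by (auto simp: space_embed_measure dest: injD)
    ultimately show ?thesis
      using emeasure_embed_measure_image[OF j] by (metis measure_def)
  qed
  then show ?thesis
    by (simp add: simple_integral_on_def space_embed_measure image_image)
qed

lemma seminorm_approx_embed_measure:
  assumes j: "inj j" and fs: "seminorm_approx (embed_measure M j) p f fs"
  shows "seminorm_approx M p (\<lambda>t. f (j t)) (\<lambda>n t. fs n (j t))"
proof -
  let ?N = "embed_measure M j"
  note fs = seminorm_approxD[OF fs]
  have jm: "j \<in> measurable M ?N" by (rule measurable_embed_measure2[OF j])
  have N: "distr M ?N j = ?N" by (rule embed_measure_eq_distr[OF j, symmetric])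
  have "simple_function M (\<lambda>t. fs n (j t))" for n
    by (rule simple_function_comp[OF jm fs(1)])
  moreover have "integrable M (\<lambda>t. p (fs n (j t) - f (j t)))" for n
    using integrable_distr[OF jm, unfolded N, OF fs(3)] .
  moreover have "(\<integral>t. p (fs n (j t) - f (j t)) \<partial>M) = (\<integral>t. p (fs n t - f t) \<partial>?N)" for n
    using integral_distr[OF jm borel_measurable_integrable[OF fs(3)[of n]]] by (simp add: N)
  ultimately show ?thesis
    using fs(2,4) by (simp add: seminorm_approx_def AE_embed_measure[OF j])
qed

text \<open>
  An injection \<open>j\<close> makes any measure space whose underlying type is not larger than the universe into
  a measure space over the universe: the vector measure is transported by \<open>B \<mapsto> m (j -` B)\<close>, and the
  density found there is pulled back along \<open>j\<close>. The integral by seminorm is defined by a choice, but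
  whichever indefinite integral is chosen agrees with the transported measure on measurable sets.
\<close>

lemma radon_nikodym_density:
  fixes T :: "'a::real_vector topology" and M :: "'w measure"
  assumes rnp: "radon_nikodym_property TYPE('u) T"
    and card: "(UNIV :: 'w set) \<lesssim> (UNIV :: 'u set)"
    and M: "complete_finite_measure M"
    and vm: "vector_measure T M m" and bv: "of_bounded_variation T M m"
    and ac: "absolutely_continuous_vm M m"
  obtains f where "has_integrals_by_seminorm T M f m"
proof -
  obtain j :: "'w \<Rightarrow> 'u" where j: "inj j" using card by (auto simp: lepoll_def)
  let ?N = "embed_measure M j"
  define m' where "m' = (\<lambda>B. m (j -` B))"
  have setsD: "j -` B \<in> sets M" "j ` (j -` B) = B" if "B \<in> sets ?N" for B
    using that j by (auto simp: sets_embed_measure inj_vimage_image_eq)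
  have "vector_measure T ?N m'"
    unfolding vector_measure_def
  proof (intro allI impI, elim conjE)
    fix A :: "nat \<Rightarrow> 'u set" assume "range A \<subseteq> sets ?N" "disjoint_family A"
    then have "range (\<lambda>i. j -` A i) \<subseteq> sets M \<and> disjoint_family (\<lambda>i. j -` A i)"
      using setsD(1) by (auto simp: disjoint_family_on_def)
    then show "limitin T (\<lambda>n. \<Sum>i<n. m' (A i)) (m' (\<Union>i. A i)) sequentially"
      using vm[unfolded vector_measure_def, rule_format, of "\<lambda>i. j -` A i"]
      by (simp add: m'_def vimage_UN)
  qed
  moreover have "of_bounded_variation T ?N m'"
    unfolding of_bounded_variation_def
  proof
    fix p assume p: "p \<in> cont_seminorms T"
    have "{\<Sum>A\<in>\<pi>. p (m' A) |\<pi>. finite \<pi> \<and> \<pi> \<subseteq> sets ?N \<and> partition_on (space ?N) \<pi>} \<subseteq>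
        {\<Sum>A\<in>\<pi>. p (m A) |\<pi>. finite \<pi> \<and> \<pi> \<subseteq> sets M \<and> partition_on (space M) \<pi>}"
    proof
      fix v assume "v \<in> {\<Sum>A\<in>\<pi>. p (m' A) |\<pi>. finite \<pi> \<and> \<pi> \<subseteq> sets ?N \<and> partition_on (space ?N) \<pi>}"
      then obtain \<pi> where v: "v = (\<Sum>A\<in>\<pi>. p (m' A))"
        and \<pi>: "finite \<pi>" "\<pi> \<subseteq> sets ?N" "partition_on (space ?N) \<pi>" by blast
      have inj: "inj_on ((-`) j) \<pi>"
        using setsD(2) \<pi>(2) by (intro inj_on_inverseI[of _ "(`) j"]) auto
      have "v = (\<Sum>A\<in>(-`) j ` \<pi>. p (m A))"
        by (simp add: v m'_def sum.reindex[OF inj])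
      moreover have "(-`) j ` \<pi> \<subseteq> sets M" using \<pi>(2) setsD(1) by auto
      moreover have "partition_on (space M) ((-`) j ` \<pi>)"
      proof (rule partition_onI)
        have "\<Union> ((-`) j ` \<pi>) = j -` \<Union>\<pi>" by auto
        also have "\<dots> = space M"
          using \<pi>(3) j by (simp add: partition_on_def space_embed_measure inj_vimage_image_eq)
        finally show "\<Union> ((-`) j ` \<pi>) = space M" .
        show "{} \<notin> (-`) j ` \<pi>"
        proof
          assume "{} \<in> (-`) j ` \<pi>"
          then obtain B where B: "B \<in> \<pi>" "j -` B = {}" by auto
          then have "B = {}" using setsD(2)[of B] \<pi>(2) by auto
          then show False using B \<pi>(3) by (simp add: partition_on_def)
        qed
        fix A B assume "A \<in> (-`) j ` \<pi>" "B \<in> (-`) j ` \<pi>" "A \<noteq> B"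
        then obtain A' B' where "A' \<in> \<pi>" "B' \<in> \<pi>" "A' \<noteq> B'" "A = j -` A'" "B = j -` B'" by auto
        then show "disjnt A B"
          using \<pi>(3) by (auto simp: partition_on_def disjoint_def disjnt_def)
      qed
      ultimately show "v \<in> {\<Sum>A\<in>\<pi>. p (m A) |\<pi>. finite \<pi> \<and> \<pi> \<subseteq> sets M \<and> partition_on (space M) \<pi>}"
        using \<pi>(1) by blast
    qed
    then show "bdd_above {\<Sum>A\<in>\<pi>. p (m' A) |\<pi>. finite \<pi> \<and> \<pi> \<subseteq> sets ?N \<and> partition_on (space ?N) \<pi>}"
      using bv p unfolding of_bounded_variation_def by (meson bdd_above_mono)
  qed
  moreover have "absolutely_continuous_vm ?N m'"
    unfolding absolutely_continuous_vm_def
  proof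
    fix Z assume Z: "Z \<in> null_sets ?N"
    then have "emeasure M (j -` Z) = 0"
      using setsD[of Z] emeasure_embed_measure_image[OF j, of "j -` Z"] by (auto simp: null_sets_def)
    then have "j -` Z \<in> null_sets M" using setsD(1)[of Z] Z by (auto simp: null_sets_def)
    then show "m' Z = 0" using ac by (simp add: m'_def absolutely_continuous_vm_def)
  qed
  ultimately obtain f where f: "integrable_by_seminorm T ?N f"
    and m': "\<And>B. B \<in> sets ?N \<Longrightarrow> m' B = integral_by_seminorm T ?N f B"
    using rnp complete_finite_measure_embed_measure[OF j M] unfolding radon_nikodym_property_def by blast
  have "has_integrals_by_seminorm T ?N f (integral_by_seminorm T ?N f)"
    using f unfolding integrable_by_seminorm_def integral_by_seminorm_def by (rule someI_ex)
  then obtain fs where fs: "\<And>p. p \<in> cont_seminorms T \<Longrightarrow> seminorm_approx ?N p f (fs p)"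
    and lim: "\<And>p B. p \<in> cont_seminorms T \<Longrightarrow> B \<in> sets ?N \<Longrightarrow>
      (\<lambda>n. p (integral_by_seminorm T ?N f B - simple_integral_on ?N (fs p n) B)) \<longlonglongrightarrow> 0"
    unfolding has_integrals_by_seminorm_def by blast
  have "(\<lambda>n. p (m E - simple_integral_on M (\<lambda>t. fs p n (j t)) E)) \<longlonglongrightarrow> 0"
    if p: "p \<in> cont_seminorms T" and E: "E \<in> sets M" for p E
  proof -
    have "m E = integral_by_seminorm T ?N f (j ` E)"
      using m'[OF in_sets_embed_measure[OF E]] j by (simp add: m'_def inj_vimage_image_eq)
    then show ?thesis
      using lim[OF p in_sets_embed_measure[OF E]] seminorm_approxD(1)[OF fs[OF p]]
      by (simp add: simple_integral_on_embed_measure[OF j _ E])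
  qed
  then have "has_integrals_by_seminorm T M (\<lambda>t. f (j t)) m"
    unfolding has_integrals_by_seminorm_def
    using seminorm_approx_embed_measure[OF j fs] by (intro exI[of _ "\<lambda>p n t. fs p n (j t)"]) auto
  then show thesis by (rule that)
qed

section \<open>The Radon-Nikodym property implies \<open>B\<close>-local convexity\<close>

lemma radon_nikodym_imp_B_locally_convex:
  fixes T :: "'a::real_vector topology" and M :: "'w measure"
  assumes T: "complete_lcs T" and rnp: "radon_nikodym_property TYPE('u) T"
    and card: "(UNIV :: 'w set) \<lesssim> (UNIV :: 'u set)"
    and M: "complete_finite_measure M"
  shows "B_locally_convex M T"
  unfolding B_locally_convex_def
proof (intro conjI allI impI)
  let ?S = "cont_seminorms T"
  show lcs: "hausdorff_lcs T" using T by (simp add: complete_lcs_def)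
  fix f assume f: "almost_same_Bochner_net T M f"
  have "\<forall>p\<in>?S. \<exists>I. has_seminorm_integrals M p (f p) I"
    using f seminorm_Bochner_integrable_has_integrals unfolding almost_same_Bochner_net_def by blast
  then have "\<exists>I. \<forall>p\<in>?S. has_seminorm_integrals M p (f p) (I p)"
    by (rule bchoice)
  then obtain I where I: "\<And>p. p \<in> ?S \<Longrightarrow> has_seminorm_integrals M p (f p) (I p)"
    by blast
  have net: "p (I p E - I q E) = 0"
    if p: "p \<in> ?S" and q: "q \<in> ?S" and le: "p \<le> q" and E: "E \<in> sets M" for p q E
  proof -
    note sem = cont_seminorms_seminorm[OF p]
    have diff: "has_seminorm_integrals M p (\<lambda>t. f p t - f q t) (\<lambda>E. I p E - I q E)"
      by (intro has_seminorm_integrals_diff[OF M sem] I p has_seminorm_integrals_mono[OF M sem le] q)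
    have "AE t in M. p (f p t - f q t) = 0"
      using f p q le by (simp add: almost_same_Bochner_net_def almost_same_net_def)
    then have "(LINT t:E|M. p (f p t - f q t)) = 0"
      unfolding set_lebesgue_integral_def by (intro integral_eq_zero_AE) auto
    then show ?thesis
      using has_seminorm_integrals_le[OF M sem diff E] seminorm_nonneg[OF sem, of "I p E - I q E"]
      by simp
  qed
  have "\<exists>x. \<forall>p\<in>?S. p (x - I p E) = 0" if E: "E \<in> sets M" for E
  proof (rule complete_lcs_net_limit[OF T, of "\<lambda>p. I p E"])
    fix p q assume "p \<in> ?S" "q \<in> ?S" "p \<le> q"
    then show "p (I p E - I q E) = 0" using E by (rule net)
  next
    fix l assume "\<And>p. p \<in> ?S \<Longrightarrow> p (l - I p E) = 0"
    then show ?thesis by (intro exI ballI)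
  qed
  then have "\<forall>E\<in>sets M. \<exists>x. \<forall>p\<in>?S. p (x - I p E) = 0" by blast
  then have "\<exists>m. \<forall>E\<in>sets M. \<forall>p\<in>?S. p (m E - I p E) = 0" by (rule bchoice)
  then obtain m where m: "\<And>E p. E \<in> sets M \<Longrightarrow> p \<in> ?S \<Longrightarrow> p (m E - I p E) = 0"
    by blast
  have add: "m (E \<union> F) = m E + m F" if E: "E \<in> sets M" "F \<in> sets M" "E \<inter> F = {}" for E F
  proof -
    have "p (m (E \<union> F) - (m E + m F)) = 0" if p: "p \<in> ?S" for p
    proof -
      note sem = cont_seminorms_seminorm[OF p]
      let ?d = "\<lambda>E. m E - I p E"
      have "p (m (E \<union> F) - (m E + m F)) =
          p ((?d (E \<union> F) - (?d E + ?d F)) + (I p (E \<union> F) - (I p E + I p F)))"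
        by (simp add: algebra_simps)
      also have "\<dots> \<le> p (?d (E \<union> F)) + (p (?d E) + p (?d F)) + p (I p (E \<union> F) - (I p E + I p F))"
        using seminorm_triangle[OF sem, of "?d (E \<union> F) - (?d E + ?d F)" "I p (E \<union> F) - (I p E + I p F)"]
          seminorm_diff_le[OF sem, of "?d (E \<union> F)" "?d E + ?d F"]
          seminorm_triangle[OF sem, of "?d E" "?d F"] by linarith
      also have "\<dots> = 0"
        using m[OF _ p] E has_seminorm_integrals_Un[OF M sem I[OF p] E] by simp
      finally show ?thesis using seminorm_nonneg[OF sem] by (intro antisym)
    qed
    then show ?thesis using cont_seminorms_separate[OF lcs, of "m (E \<union> F) - (m E + m F)"] by simp
  qed
  have dom: "\<exists>h. integrable M h \<and> (\<forall>t. 0 \<le> h t) \<and> (\<forall>E\<in>sets M. p (m E) \<le> (LINT t:E|M. h t))"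
    if p: "p \<in> ?S" for p
  proof (intro exI conjI ballI allI)
    note sem = cont_seminorms_seminorm[OF p]
    show "integrable M (\<lambda>t. p (f p t))"
      by (rule has_seminorm_integrals_integrable[OF M sem I[OF p]])
    show "0 \<le> p (f p t)" for t by (simp add: sem)
    fix E assume E: "E \<in> sets M"
    have "p (m E) \<le> p (I p E)" using seminorm_le_diff[OF sem, of "m E" "I p E"] m[OF E p] by simp
    also have "\<dots> \<le> (LINT t:E|M. p (f p t))"
      by (rule has_seminorm_integrals_le[OF M sem I[OF p] E])
    finally show "p (m E) \<le> (LINT t:E|M. p (f p t))" .
  qed
  obtain g where g: "has_integrals_by_seminorm T M g m"
    using radon_nikodym_density[OF rnp card M dominated_vector_measure[OF lcs add dom]] by blast
  show "\<exists>g. \<forall>s\<in>?S. integrable M (\<lambda>t. s (g t - f s t)) \<and> (\<integral>t. s (g t - f s t) \<partial>M) = 0"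
  proof (intro exI ballI conjI)
    fix s assume s: "s \<in> ?S"
    note sem = cont_seminorms_seminorm[OF s]
    have diff: "has_seminorm_integrals M s (\<lambda>t. g t - f s t) (\<lambda>E. m E - I s E)"
      using g s by (intro has_seminorm_integrals_diff[OF M sem] I) (auto simp: has_integrals_by_seminorm_iff)
    show "integrable M (\<lambda>t. s (g t - f s t))"
      by (rule has_seminorm_integrals_integrable[OF M sem diff])
    show "(\<integral>t. s (g t - f s t) \<partial>M) = 0"
      by (rule has_seminorm_integrals_zero[OF M sem diff]) (rule m[OF _ s])
  qed
qed

section \<open>Normed spaces\<close>

lemma hausdorff_lcs_euclidean: "hausdorff_lcs (euclidean :: 'b::real_normed_vector topology)"
  unfolding hausdorff_lcs_def
proof (intro conjI allI impI)
  fix U :: "'b set" assume "openin euclidean U \<and> 0 \<in> U"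
  then obtain e where "e > 0" "ball 0 e \<subseteq> U" by (auto simp: open_contains_ball)
  then show "\<exists>V. openin euclidean V \<and> 0 \<in> V \<and> convex V \<and> V \<subseteq> U"
    by (intro exI[of _ "ball 0 e"]) auto
qed (auto simp: case_prod_unfold intro!: continuous_intros)

lemma complete_lcs_euclidean:
  assumes complete: "complete (UNIV :: 'b::real_normed_vector set)"
  shows "complete_lcs (euclidean :: 'b topology)"
  unfolding complete_lcs_def
proof (intro conjI allI impI hausdorff_lcs_euclidean)
  fix F :: "'b filter" assume F: "lcs_cauchy_filter euclidean F"
  have "cauchy_filter F"
    unfolding cauchy_filter_metric
  proof (intro allI impI)
    fix e :: real assume "e > 0"
    then have "eventually (\<lambda>(x, y). x - y \<in> ball 0 e) (F \<times>\<^sub>F F)"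
      using F[unfolded lcs_cauchy_filter_def, THEN conjunct2, rule_format, of "ball 0 e"] by simp
    then have "eventually (\<lambda>(x, y). dist x y < e) (F \<times>\<^sub>F F)"
      by (simp add: dist_norm norm_minus_commute case_prod_unfold)
    then show "\<exists>P. eventually P F \<and> (\<forall>x y. P x \<and> P y \<longrightarrow> dist x y < e)"
      by (auto simp: eventually_prod_same)
  qed
  moreover have "F \<noteq> bot" using F by (simp add: lcs_cauchy_filter_def)
  ultimately obtain l where "F \<le> nhds l"
    using cauchy_filter_complete_converges[OF _ complete, of F] by auto
  then show "\<exists>l. limitin euclidean (\<lambda>x. x) l F"
    by (auto simp: filterlim_def filtermap_ident)
qed

lemma cont_seminorms_euclidean_iff:
  fixes p :: "'b::real_normed_vector \<Rightarrow> real"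
  shows "p \<in> cont_seminorms euclidean \<longleftrightarrow> seminorm p \<and> (\<exists>C. \<forall>x. p x \<le> C * norm x)"
proof (intro iffI conjI; (elim conjE exE)?)
  assume p: "p \<in> cont_seminorms euclidean"
  then show sem: "seminorm p" by (rule cont_seminorms_seminorm)
  have "continuous_on UNIV p" using p by (simp add: cont_seminorms_def)
  then have "open {x. p x < 1}" by (intro open_Collect_less continuous_intros)
  moreover have "0 \<in> {x. p x < 1}" by (simp add: sem)
  ultimately obtain e where e: "e > 0" "ball 0 e \<subseteq> {x. p x < 1}"
    by (meson open_contains_ball)
  have "p x \<le> 2 / e * norm x" for x
  proof (cases "x = 0")
    case False
    let ?c = "e / (2 * norm x)"
    have "?c *\<^sub>R x \<in> ball 0 e" using e(1) False by simp
    then have "p (?c *\<^sub>R x) < 1" using e(2) by blast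
    then show ?thesis using e(1) False by (simp add: seminorm_scaleR[OF sem] field_simps)
  qed (simp add: sem)
  then show "\<exists>C. \<forall>x. p x \<le> C * norm x" by blast
next
  fix C assume p: "seminorm p" and C: "\<forall>x. p x \<le> C * norm x"
  have "\<bar>C\<bar>-lipschitz_on UNIV p"
  proof (rule lipschitz_onI)
    fix x y
    have "dist (p x) (p y) \<le> p (x - y)"
      using seminorm_reverse_triangle[OF p] by (simp add: dist_real_def)
    also have "\<dots> \<le> C * norm (x - y)" using C by blast
    also have "\<dots> \<le> \<bar>C\<bar> * norm (x - y)" by (intro mult_right_mono) auto
    finally show "dist (p x) (p y) \<le> \<bar>C\<bar> * dist x y" by (simp add: dist_norm)
  qed simp
  then have "continuous_on UNIV p" by (rule lipschitz_on_continuous_on)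
  then show "p \<in> cont_seminorms euclidean" using p by (simp add: cont_seminorms_def)
qed

lemma seminorm_norm: "c \<ge> 0 \<Longrightarrow> seminorm (\<lambda>x::'b::real_normed_vector. c * norm x)"
  by (simp add: seminorm_def mult_left_mono norm_triangle_ineq flip: distrib_left)

text \<open>
  Given a continuous seminorm \<open>s\<close>, a large multiple \<open>q\<close> of the norm dominates both \<open>s\<close> and the norm.
  Then \<open>f q\<close> equals the function at the norm almost everywhere, since the norm separates
  points, and it is \<open>s\<close>-equal to \<open>f s\<close> almost everywhere. Hence the function at the norm solves the
  problem for every \<open>s\<close>.
\<close>

lemma B_locally_convex_euclidean:
  assumes M: "complete_finite_measure M"
  shows "B_locally_convex M (euclidean :: 'b::real_normed_vector topology)"
  unfolding B_locally_convex_def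
proof (intro conjI allI impI hausdorff_lcs_euclidean)
  let ?S = "cont_seminorms (euclidean :: 'b topology)"
  have norm: "(\<lambda>x. c * norm x) \<in> ?S" if "c \<ge> 0" for c
    using seminorm_norm[OF that] by (auto simp: cont_seminorms_euclidean_iff)
  fix f assume f: "almost_same_Bochner_net (euclidean :: 'b topology) M f"
  \<comment> \<open>The factor \<open>1\<close> makes the norm an instance of the multiples in \<open>norm\<close> above.\<close>
  let ?n = "\<lambda>x :: 'b. 1 * norm x"
  show "\<exists>g. \<forall>s\<in>?S. integrable M (\<lambda>t. s (g t - f s t)) \<and> (\<integral>t. s (g t - f s t) \<partial>M) = 0"
  proof (intro exI[of _ "f ?n"] ballI)
    fix s assume s: "s \<in> ?S"
    then have sem: "seminorm s" by (rule cont_seminorms_seminorm)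
    obtain C where C: "\<And>x. s x \<le> C * norm x" using s by (auto simp: cont_seminorms_euclidean_iff)
    let ?q = "\<lambda>x :: 'b. max 1 C * norm x"
    have same: "AE t in M. p (f p t - f ?q t) = 0" if "p \<in> ?S" "p \<le> ?q" for p
      using f that norm[of "max 1 C"] by (simp add: almost_same_Bochner_net_def almost_same_net_def)
    have "s x \<le> max 1 C * norm x" for x
      by (rule order_trans[OF C]) (intro mult_right_mono; simp)
    then have "s \<le> ?q" by (simp add: le_fun_def)
    then have AEs: "AE t in M. s (f s t - f ?q t) = 0" by (rule same[OF s])
    have "?n \<le> ?q" by (intro le_funI mult_right_mono) auto
    then have "AE t in M. ?n (f ?n t - f ?q t) = 0" using norm[of 1] by (intro same) simp_all
    with AEs have AE: "AE t in M. s (f ?n t - f s t) = 0"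
    proof eventually_elim
      case (elim t)
      then have "f ?n t = f ?q t" by simp
      then show ?case using elim(1) seminorm_minus_commute[OF sem, of "f ?q t" "f s t"] by simp
    qed
    then have "(\<lambda>t. s (f ?n t - f s t)) \<in> borel_measurable M"
      using M by (intro complete_measure_measurable_AE[OF _ borel_measurable_const[of 0] AE])
        (simp add: complete_finite_measure_def)
    then have "integrable M (\<lambda>t. s (f ?n t - f s t))"
      using integrable_cong_AE[of "\<lambda>t. s (f ?n t - f s t)" M "\<lambda>_. 0"] AE by simp
    with AE show "integrable M (\<lambda>t. s (f ?n t - f s t)) \<and> (\<integral>t. s (f ?n t - f s t) \<partial>M) = 0"
      by (simp add: integral_eq_zero_AE)
  qed
qed

section \<open>A vector measure in \<open>\<ell>\<^sub>\<infinity>\<close> without density\<close>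

lemma complete_finite_measure_lebesgue_on:
  assumes S: "S \<in> lmeasurable"
  shows "complete_finite_measure (lebesgue_on S)"
  unfolding complete_finite_measure_def
proof
  have S': "S \<in> sets lebesgue" using S by (rule fmeasurableD)
  show "complete_measure (lebesgue_on S)"
  proof
    fix A B assume B: "B \<subseteq> A" and "A \<in> null_sets (lebesgue_on S)"
    then have A: "A \<in> null_sets lebesgue" "A \<subseteq> S" using S' by (auto simp: null_sets_restrict_space)
    have "B \<in> null_sets lebesgue" by (rule completion.complete2[OF B A(1)])
    then show "B \<in> sets (lebesgue_on S)"
      using A B S' by (auto simp: sets_restrict_space_iff)
  qed
  show "finite_measure (lebesgue_on S)"
    using S S' by (intro finite_measureI) (simp add: emeasure_restrict_space space_restrict_space fmeasurable_def)
qed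

text \<open>
  A Cauchy sequence converges uniformly, and its uniform limit inherits continuity and boundedness.
\<close>

lemma complete_UNIV_bcontfun:
  "complete (UNIV :: ('i::topological_space \<Rightarrow>\<^sub>C 'b::complete_space) set)"
  unfolding complete_def
proof (intro allI impI)
  fix f :: "nat \<Rightarrow> 'i \<Rightarrow>\<^sub>C 'b" assume "(\<forall>n. f n \<in> UNIV) \<and> Cauchy f"
  then have "Cauchy f" by simp
  then have "\<exists>g. uniform_limit UNIV (\<lambda>n. apply_bcontfun (f n)) g sequentially"
    using uniformly_convergent_eq_cauchy[of "\<lambda>_. True" "\<lambda>n. apply_bcontfun (f n)"]
    unfolding Cauchy_def uniform_limit_sequentially_iff
    by (metis dist_fun_lt_imp_dist_val_lt)
  then obtain g where "uniform_limit UNIV (\<lambda>n. apply_bcontfun (f n)) g sequentially" by blast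
  from uniform_limit_bcontfunE[OF this sequentially_bot]
  obtain l where "f \<longlonglongrightarrow> l" by metis
  then show "\<exists>l\<in>UNIV. f \<longlonglongrightarrow> l" by blast
qed

lemma bounded_linear_apply_bcontfun:
  "bounded_linear (\<lambda>x :: 'i::topological_space \<Rightarrow>\<^sub>C real. apply_bcontfun x k)"
proof (rule bounded_linear_intro[of _ 1])
  show "norm (apply_bcontfun x k) \<le> norm x * 1" for x :: "'i \<Rightarrow>\<^sub>C real"
    using norm_bounded[of x k] by simp
qed simp_all

lemma apply_simple_integral_on:
  fixes g :: "'w \<Rightarrow> ('i::topological_space \<Rightarrow>\<^sub>C real)"
  assumes M: "finite_measure M" and g: "simple_function M g" and E: "E \<in> sets M"
  shows "apply_bcontfun (simple_integral_on M g E) k = (LINT t:E|M. apply_bcontfun (g t) k)"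
proof -
  interpret bounded_linear "\<lambda>x :: 'i \<Rightarrow>\<^sub>C real. apply_bcontfun x k"
    by (rule bounded_linear_apply_bcontfun)
  show ?thesis
    using set_integral_simple_compose[OF M g E, of "\<lambda>x. apply_bcontfun x k"]
    by (simp add: simple_integral_on_def sum)
qed

text \<open>
  The indefinite integral, taken coordinatewise, of \<open>t \<mapsto> (indicator (A n) t)\<^sub>n\<close>.
\<close>

definition slice_measure :: "'w measure \<Rightarrow> (nat \<Rightarrow> 'w set) \<Rightarrow> 'w set \<Rightarrow> (nat \<Rightarrow>\<^sub>C real)" where
  "slice_measure M A E = Bcontfun (\<lambda>n. measure M (E \<inter> A n))"

lemma apply_slice_measure:
  assumes M: "finite_measure M"
  shows "apply_bcontfun (slice_measure M A E) n = measure M (E \<inter> A n)"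
proof -
  have "(\<lambda>n. measure M (E \<inter> A n)) \<in> bcontfun"
    using finite_measure.bounded_measure[OF M]
    by (intro bcontfun_normI[of _ "measure M (space M)"]) auto
  then show ?thesis by (simp add: slice_measure_def Bcontfun_inverse)
qed

lemma slice_measure_properties:
  assumes M: "finite_measure M" and A: "range A \<subseteq> sets M"
  shows "vector_measure euclidean M (slice_measure M A)"
    and "of_bounded_variation euclidean M (slice_measure M A)"
    and "absolutely_continuous_vm M (slice_measure M A)"
proof -
  interpret finite_measure M by fact
  let ?m = "slice_measure M A"
  have lcs: "hausdorff_lcs (euclidean :: (nat \<Rightarrow>\<^sub>C real) topology)"
    by (rule hausdorff_lcs_euclidean)
  have add: "?m (E \<union> F) = ?m E + ?m F" if E: "E \<in> sets M" "F \<in> sets M" "E \<inter> F = {}" for E F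
  proof (rule bcontfun_eqI)
    fix n
    have "measure M ((E \<inter> A n) \<union> (F \<inter> A n)) = measure M (E \<inter> A n) + measure M (F \<inter> A n)"
      using E A by (intro finite_measure_Union) auto
    then show "apply_bcontfun (?m (E \<union> F)) n = apply_bcontfun (?m E + ?m F) n"
      by (simp add: apply_slice_measure[OF M] Int_Un_distrib2)
  qed
  have dom: "\<exists>h. integrable M h \<and> (\<forall>t. 0 \<le> h t) \<and> (\<forall>E\<in>sets M. p (?m E) \<le> (LINT t:E|M. h t))"
    if p: "p \<in> cont_seminorms euclidean" for p
  proof -
    obtain C where C: "\<And>x. p x \<le> C * norm x" using p by (auto simp: cont_seminorms_euclidean_iff)
    show ?thesis
    proof (intro exI[of _ "\<lambda>_. \<bar>C\<bar>"] conjI ballI allI)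
      fix E assume E: "E \<in> sets M"
      have "norm (?m E) \<le> measure M E"
        using E A by (intro norm_bound) (auto simp: apply_slice_measure[OF M] intro!: finite_measure_mono)
      then have "\<bar>C\<bar> * norm (?m E) \<le> \<bar>C\<bar> * measure M E" by (intro mult_left_mono) auto
      moreover have "p (?m E) \<le> \<bar>C\<bar> * norm (?m E)"
        by (rule order_trans[OF C]) (intro mult_right_mono; simp)
      ultimately show "p (?m E) \<le> (LINT t:E|M. \<bar>C\<bar>)"
        using sets.sets_into_space[OF E]
        by (simp add: set_lebesgue_integral_def mult.commute Int_absorb2)
    qed auto
  qed
  show "vector_measure euclidean M ?m" "of_bounded_variation euclidean M ?m"
    "absolutely_continuous_vm M ?m"
    by (rule dominated_vector_measure[OF lcs add dom]; assumption)+
qed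

text \<open>
  For the seminorm \<open>x \<mapsto> \<bar>x k\<bar>\<close> the simple function \<open>t \<mapsto> indicator (A k) t \<cdot> (1, 1, \<dots>)\<close> has
  the same integrals as \<open>f\<close>, so it agrees with \<open>f\<close> in the coordinate \<open>k\<close> almost everywhere. The expected
  density \<open>t \<mapsto> (indicator (A n) t)\<^sub>n\<close> itself would not do for this comparison, as it need not be
  approximable by simple functions.
\<close>

lemma slice_measure_density_AE:
  assumes M: "complete_finite_measure M" and A: "range A \<subseteq> sets M"
    and f: "has_integrals_by_seminorm euclidean M f (slice_measure M A)"
  shows "AE t in M. apply_bcontfun (f t) k = indicator (A k) t"
proof -
  have fin: "finite_measure M" using M by (simp add: complete_finite_measure_def)
  define p where "p = (\<lambda>x :: nat \<Rightarrow>\<^sub>C real. \<bar>apply_bcontfun x k\<bar>)"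
  have sem: "seminorm p" by (simp add: p_def seminorm_def abs_mult abs_triangle_ineq)
  have "p x \<le> 1 * norm x" for x using norm_bounded[of x k] by (simp add: p_def)
  with sem have p: "p \<in> cont_seminorms euclidean" unfolding cont_seminorms_euclidean_iff by blast
  define g where "g = (\<lambda>t. indicator (A k) t *\<^sub>R (const_bcontfun 1 :: nat \<Rightarrow>\<^sub>C real))"
  have g: "simple_function M g"
    unfolding g_def using A
    by (intro simple_function_compose1[where g = "\<lambda>c. c *\<^sub>R const_bcontfun 1"] simple_function_indicator) auto
  have gk: "apply_bcontfun (g t) k = indicator (A k) t" for t
    by (simp add: g_def const_bcontfun.rep_eq)
  have diff: "has_seminorm_integrals M p (\<lambda>t. f t - g t)
      (\<lambda>E. slice_measure M A E - simple_integral_on M g E)"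
    using f p by (intro has_seminorm_integrals_diff[OF M sem] has_seminorm_integrals_simple[OF sem g])
      (auto simp: has_integrals_by_seminorm_iff)
  have "(\<integral>t. p (f t - g t) \<partial>M) = 0"
  proof (rule has_seminorm_integrals_zero[OF M sem diff])
    fix E assume E: "E \<in> sets M"
    have "(LINT t:E|M. indicator (A k) t) = measure M (E \<inter> A k)"
      using E A by (simp add: set_lebesgue_integral_def indicator_inter_arith[symmetric] sets.Int)
    then show "p (slice_measure M A E - simple_integral_on M g E) = 0"
      by (simp add: p_def apply_slice_measure[OF fin] apply_simple_integral_on[OF fin g E] gk)
  qed
  moreover have "integrable M (\<lambda>t. p (f t - g t))"
    by (rule has_seminorm_integrals_integrable[OF M sem diff])
  ultimately have "AE t in M. p (f t - g t) = 0"
    by (subst integral_nonneg_eq_0_iff_AE[symmetric]) (simp_all add: sem)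
  then show ?thesis by eventually_elim (simp add: p_def gk)
qed

lemma countable_if_subsingleton:
  assumes "\<And>x y. x \<in> S \<Longrightarrow> y \<in> S \<Longrightarrow> x = y"
  shows "countable S"
proof (cases "S = {}")
  case False
  then obtain x where "x \<in> S" by blast
  then have "S \<subseteq> {x}" using assms by blast
  then show ?thesis by (rule countable_subset) simp
qed simp

text \<open>
  \<open>P\<close> is the set of points where \<open>f\<close> has the value forced by the measure, and \<open>G\<close> the set of those that
  some simple approximant meets with an error below \<open>1 / 2\<close>. By \<open>apart\<close> each value of an approximant
  serves at most one point of \<open>P\<close>, so \<open>G\<close> is countable, although almost every point of the unit
  interval belongs to it.
\<close>

lemma not_radon_nikodym_bcontfun:
  assumes card: "(UNIV :: real set) \<lesssim> (UNIV :: 'u set)"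
  shows "\<not> radon_nikodym_property TYPE('u) (euclidean :: (nat \<Rightarrow>\<^sub>C real) topology)"
proof
  assume rnp: "radon_nikodym_property TYPE('u) (euclidean :: (nat \<Rightarrow>\<^sub>C real) topology)"
  define M where "M = lebesgue_on {0..1::real}"
  define q where "q = (\<lambda>n. of_rat (from_nat n) :: real)"
  define A where "A = (\<lambda>n. {0..1} \<inter> {q n..})"
  have M: "complete_finite_measure M"
    unfolding M_def by (rule complete_finite_measure_lebesgue_on) simp
  then have fin: "finite_measure M" by (simp add: complete_finite_measure_def)
  have space: "space M = {0..1}" by (simp add: M_def space_restrict_space)
  have A: "range A \<subseteq> sets M"
    by (auto simp: M_def A_def sets_restrict_space_iff)
  obtain f where f: "has_integrals_by_seminorm euclidean M f (slice_measure M A)"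
    using radon_nikodym_density[OF rnp card M slice_measure_properties[OF fin A]] by blast
  have "(\<lambda>x :: nat \<Rightarrow>\<^sub>C real. 1 * norm x) \<in> cont_seminorms euclidean"
    unfolding cont_seminorms_euclidean_iff by (intro conjI seminorm_norm exI[of _ 1]) simp_all
  then obtain fs where "seminorm_approx M (\<lambda>x. 1 * norm x) f fs"
    using f by (auto simp: has_integrals_by_seminorm_def)
  note fs = seminorm_approxD(1,2)[OF this]
  define P where "P = {t \<in> space M. \<forall>k. apply_bcontfun (f t) k = indicator (A k) t}"
  have apart: "1 \<le> norm (f s - f t)" if s: "s \<in> P" and t: "t \<in> P" and "s < t" for s t
  proof -
    obtain r where r: "s < of_rat r" "of_rat r < t"
      using of_rat_dense[OF \<open>s < t\<close>] by blast
    have "q (to_nat r) = of_rat r" by (simp add: q_def)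
    then have "apply_bcontfun (f s) (to_nat r) = 0" "apply_bcontfun (f t) (to_nat r) = 1"
      using s t r by (auto simp: P_def A_def space)
    then show ?thesis using norm_bounded[of "f s - f t" "to_nat r"] by simp
  qed
  define G where "G = (\<Union>n. \<Union>x\<in>fs n ` space M. {t \<in> P. fs n t = x \<and> norm (x - f t) < 1 / 2})"
  have "countable {t \<in> P. fs n t = x \<and> norm (x - f t) < 1 / 2}" for n x
  proof (rule countable_if_subsingleton)
    fix s t
    assume "s \<in> {t \<in> P. fs n t = x \<and> norm (x - f t) < 1 / 2}"
      "t \<in> {t \<in> P. fs n t = x \<and> norm (x - f t) < 1 / 2}"
    then have st: "s \<in> P" "t \<in> P" and near: "dist x (f s) < 1 / 2" "dist x (f t) < 1 / 2"
      by (auto simp: dist_norm)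
    have "norm (f s - f t) < 1"
      using dist_triangle_half_r[OF near] by (simp add: dist_norm)
    then show "s = t"
      using apart[OF st] apart[OF st(2,1)] norm_minus_commute[of "f s" "f t"]
      by (cases s t rule: linorder_cases) auto
  qed
  moreover have "countable (fs n ` space M)" for n
    using fs(1)[of n] by (simp add: simple_function_def countable_finite)
  ultimately have "countable G"
    unfolding G_def by (intro countable_UN) auto
  have "AE t in M. \<forall>k. apply_bcontfun (f t) k = indicator (A k) t"
    unfolding AE_all_countable by (intro allI slice_measure_density_AE[OF M A f])
  with fs(2) AE_space have "AE t in M. t \<in> G"
  proof eventually_elim
    case (elim t)
    obtain n where "1 * norm (fs n t - f t) < 1 / 2"
      using order_tendstoD(2)[OF elim(1), of "1 / 2"] eventually_happens'[OF sequentially_bot] by force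
    then show ?case using elim by (auto simp: G_def P_def)
  qed
  then have "AE t in lebesgue. t \<in> {0..1} \<longrightarrow> t \<in> G"
    unfolding M_def by (subst (asm) AE_restrict_space_iff) auto
  moreover have "AE t in lebesgue. t \<notin> G"
    using countable_imp_null_set_lborel[OF \<open>countable G\<close>] by (intro AE_not_in null_sets_completionI)
  ultimately have "AE t in lebesgue. t \<notin> {0..1::real}" by eventually_elim blast
  then have "emeasure lebesgue {0..1::real} = 0"
    by (subst (asm) AE_iff_null_sets[symmetric]) auto
  then show False by simp
qed

section \<open>Proper containment\<close>

theorem mainTheorem4:
  fixes M :: "'w measure"
  assumes "complete_finite_measure M"
    and "(UNIV :: 'w set) \<lesssim> (UNIV :: 'u set)"
    and "(UNIV :: real set) \<lesssim> (UNIV :: 'u set)"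
  shows "(\<forall>T :: 'a::real_vector topology.
            complete_lcs T \<and> radon_nikodym_property TYPE('u) T \<longrightarrow>
            B_locally_convex M T) \<and>
         (\<exists>T :: (nat \<Rightarrow>\<^sub>C real) topology.
            complete_lcs T \<and> B_locally_convex M T \<and> \<not> radon_nikodym_property TYPE('u) T)"
proof (intro conjI allI impI)
  fix T :: "'a topology"
  assume "complete_lcs T \<and> radon_nikodym_property TYPE('u) T"
  then show "B_locally_convex M T"
    using radon_nikodym_imp_B_locally_convex assms by blast
next
  show "\<exists>T :: (nat \<Rightarrow>\<^sub>C real) topology.
      complete_lcs T \<and> B_locally_convex M T \<and> \<not> radon_nikodym_property TYPE('u) T"
    using complete_lcs_euclidean[OF complete_UNIV_bcontfun] B_locally_convex_euclidean[OF assms(1)]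
      not_radon_nikodym_bcontfun[OF assms(3)] by blast
qed

end
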